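(* Let $G$ be a connected $2$-minimally graph with maximum degree $\Delta$. If $G$ is not one of the cycles $C_3, C_4, C_5$ and is not a complete bipartite graph $K_{2,r^2}$ for any positive integer $r$, then $D'(G)\leq \lceil \sqrt{\Delta}\rceil$.
   Context: All graphs are simple. A connected graph $G$ with minimum degree $\delta(G)\geq 2$ is called a $\delta$-minimally graph if every proper spanning subgraph of $G$ (i.e., every graph obtained from $G$ by deleting at least one edge, keeping all vertices) has minimum degree less than $\delta(G)$; a $2$-minimally graph is such a graph with $\delta(G)=2$. The distinguishing index $D'(G)$ of a graph $G$ is the least number $d$ such that there is a labeling of the edges of $G$ with $d$ labels that is preserved only by the identity automorphism of $G$. *)

theory Defs
  imports Complex_Main
begin

text \<open>
  A simple graph is given by a finite vertex set \<open>V\<close> and a set \<open>E\<close> of edges, each edge being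
  its two-element set of endpoints.
\<close>

definition simple_graph :: "'a set \<Rightarrow> 'a set set \<Rightarrow> bool" where
  "simple_graph V E \<longleftrightarrow> finite V \<and> (\<forall>e\<in>E. e \<subseteq> V \<and> card e = 2)"

definition vertex_degree :: "'a set set \<Rightarrow> 'a \<Rightarrow> nat" where
  "vertex_degree E v = card {e \<in> E. v \<in> e}"

text \<open>Minimum and maximum degree are meaningful for a finite nonempty vertex set only.\<close>

definition min_degree :: "'a set \<Rightarrow> 'a set set \<Rightarrow> nat" where
  "min_degree V E = Min (vertex_degree E ` V)"

definition max_degree :: "'a set \<Rightarrow> 'a set set \<Rightarrow> nat" where
  "max_degree V E = Max (vertex_degree E ` V)"

definition connected_graph :: "'a set \<Rightarrow> 'a set set \<Rightarrow> bool" where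
  "connected_graph V E \<longleftrightarrow>
     V \<noteq> {} \<and> (\<forall>u\<in>V. \<forall>v\<in>V. (\<lambda>x y. {x, y} \<in> E)\<^sup>*\<^sup>* u v)"

definition minimally_graph :: "nat \<Rightarrow> 'a set \<Rightarrow> 'a set set \<Rightarrow> bool" where
  "minimally_graph \<delta> V E \<longleftrightarrow>
     simple_graph V E \<and> connected_graph V E \<and> min_degree V E = \<delta> \<and> \<delta> \<ge> 2 \<and>
     (\<forall>E'. E' \<subset> E \<longrightarrow> min_degree V E' < \<delta>)"

definition graph_iso :: "('a \<Rightarrow> 'b) \<Rightarrow> 'a set \<Rightarrow> 'a set set \<Rightarrow> 'b set \<Rightarrow> 'b set set \<Rightarrow> bool" where
  "graph_iso f V E V' E' \<longleftrightarrow>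
     bij_betw f V V' \<and> (\<forall>u\<in>V. \<forall>v\<in>V. {u, v} \<in> E \<longleftrightarrow> {f u, f v} \<in> E')"

definition isomorphic_graphs :: "'a set \<Rightarrow> 'a set set \<Rightarrow> 'b set \<Rightarrow> 'b set set \<Rightarrow> bool" where
  "isomorphic_graphs V E V' E' \<longleftrightarrow> (\<exists>f. graph_iso f V E V' E')"

abbreviation graph_automorphism :: "('a \<Rightarrow> 'a) \<Rightarrow> 'a set \<Rightarrow> 'a set set \<Rightarrow> bool" where
  "graph_automorphism f V E \<equiv> graph_iso f V E V E"

text \<open>
  Automorphisms are total functions of which only the values on \<open>V\<close> matter, so
  ``\<open>f\<close> is the identity'' means that \<open>f\<close> fixes every element of \<open>V\<close>.
\<close>

definition distinguishing_edge_labeling :: "'a set \<Rightarrow> 'a set set \<Rightarrow> ('a set \<Rightarrow> nat) \<Rightarrow> bool" where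
  "distinguishing_edge_labeling V E c \<longleftrightarrow>
     (\<forall>f. graph_automorphism f V E \<and> (\<forall>e\<in>E. c (f ` e) = c e) \<longrightarrow> (\<forall>v\<in>V. f v = v))"

text \<open>
  The labels are \<open>0, \<dots>, d - 1\<close>. A suitable \<open>d\<close> exists for every finite connected graph other
  than \<open>K\<^sub>2\<close> (an injective labeling works), in particular whenever the minimum degree is at least 2.
\<close>

definition distinguishing_index :: "'a set \<Rightarrow> 'a set set \<Rightarrow> nat" where
  "distinguishing_index V E =
     (LEAST d. \<exists>c. (\<forall>e\<in>E. c e < d) \<and> distinguishing_edge_labeling V E c)"

text \<open>The cycle on \<open>n\<close> vertices, for \<open>n \<ge> 3\<close>.\<close>

definition cycle_verts :: "nat \<Rightarrow> nat set" where
  "cycle_verts n = {..<n}"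

definition cycle_edges :: "nat \<Rightarrow> nat set set" where
  "cycle_edges n = {{i, Suc i mod n} | i. i < n}"

definition complete_bipartite_verts :: "nat \<Rightarrow> nat \<Rightarrow> (nat + nat) set" where
  "complete_bipartite_verts m n = Inl ` {..<m} \<union> Inr ` {..<n}"

definition complete_bipartite_edges :: "nat \<Rightarrow> nat \<Rightarrow> (nat + nat) set set" where
  "complete_bipartite_edges m n = {{Inl i, Inr j} | i j. i < m \<and> j < n}"

end

theory Submission
  imports Defs
begin

text \<open>
  By minimality every edge has an endpoint of degree 2; put \<open>k = \<lceil>sqrt \<Delta>\<rceil>\<close>. Suppose that some labeled
  core is fixed pointwise by every label-preserving automorphism. The fixed part can then be grown:
  at a fixed vertex \<open>h\<close> of degree at least 3 the paths of length 2 that leave the fixed part get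
  distinct pairs of labels. Since \<open>h\<close> already has a fixed neighbour there are at most \<open>k\<^sup>2 - 1\<close> of them,
  so one of the \<open>k\<^sup>2\<close> pairs is never needed, and this reserved pair makes the core recognisable.
  (Triangles \<open>h, w, z\<close> with \<open>w, z\<close> of degree 2 are special, since their two paths share the edge
  \<open>wz\<close>: they get pairwise distinct asymmetric patterns.)

  The core is a path of length 2 from a vertex of degree at least 3 through two vertices of degree 2,
  or a triangle as above. If neither exists, all edges join a vertex of degree at least 3 to one of
  degree 2. Then one takes two vertices \<open>x, y\<close> of degree at least 3 together with all their
  common neighbours, if there are at least two of these: a labeling of them by distinct pairs that
  rules out swapping \<open>x\<close> and \<open>y\<close> must omit a pair, which is where the complete bipartite graph
  with parts of size 2 and \<open>k\<^sup>2\<close> fails. If any two such vertices have at most one common neighbour, one takes a cycle with all labels 0 except for one edge.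
  Graphs without vertices of degree at least 3 are cycles.
\<close>

section \<open>Neighbourhoods and automorphisms\<close>

definition nbrs :: "'a set set \<Rightarrow> 'a \<Rightarrow> 'a set" where
  "nbrs E v = {u. {v, u} \<in> E}"

lemma nbrs_sym: "u \<in> nbrs E v \<longleftrightarrow> v \<in> nbrs E u"
  by (simp add: nbrs_def insert_commute)

lemma vertex_degree_eq_card_nbrs:
  assumes "simple_graph V E"
  shows "vertex_degree E v = card (nbrs E v)"
proof -
  have "bij_betw (\<lambda>u. {v, u}) (nbrs E v) {e \<in> E. v \<in> e}"
  proof (rule bij_betwI')
    fix e assume e: "e \<in> {e \<in> E. v \<in> e}"
    then have "card e = 2" using assms by (auto simp: simple_graph_def)
    then obtain a b where "e = {a, b}" by (auto simp: card_2_iff)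
    then show "\<exists>u\<in>nbrs E v. e = {v, u}"
      using e by (auto simp: nbrs_def insert_commute)
  qed (auto simp: nbrs_def doubleton_eq_iff)
  then show ?thesis by (simp add: vertex_degree_def bij_betw_same_card)
qed

definition label_auto :: "'a set \<Rightarrow> 'a set set \<Rightarrow> ('a set \<Rightarrow> nat) \<Rightarrow> ('a \<Rightarrow> 'a) \<Rightarrow> bool" where
  "label_auto V E c f \<longleftrightarrow> graph_automorphism f V E \<and> (\<forall>e\<in>E. c (f ` e) = c e)"

text \<open>The consequence of minimality that drives the proof is \<open>sparse\<close>: vertices
  of degree at least 3 are adjacent only to vertices of degree 2. Here \<open>k\<close> is the
  number of labels, and \<open>deg_le\<close> says that no vertex has more edges than there are
  pairs of labels.\<close>

locale sparse_graph =
  fixes V :: "'a set" and E :: "'a set set" and k :: nat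
  assumes simple: "simple_graph V E"
    and conn: "connected_graph V E"
    and deg_ge: "v \<in> V \<Longrightarrow> 2 \<le> card (nbrs E v)"
    and deg_le: "v \<in> V \<Longrightarrow> card (nbrs E v) \<le> k\<^sup>2"
    and k_ge: "2 \<le> k"
    and sparse: "{u, v} \<in> E \<Longrightarrow> card (nbrs E u) = 2 \<or> card (nbrs E v) = 2"
begin

abbreviation N where "N \<equiv> nbrs E"

lemma finite_V: "finite V"
  using simple by (simp add: simple_graph_def)

lemma edge_subset: "e \<in> E \<Longrightarrow> e \<subseteq> V"
  using simple by (auto simp: simple_graph_def)

lemma edge_cases:
  assumes "e \<in> E"
  obtains a b where "e = {a, b}" "a \<noteq> b" "a \<in> N b" "b \<in> N a"
proof -
  have "card e = 2" using simple assms by (auto simp: simple_graph_def)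
  then obtain a b where "e = {a, b}" "a \<noteq> b" by (auto simp: card_2_iff)
  then show ?thesis using that assms by (auto simp: nbrs_def insert_commute)
qed

lemma N_edge: "u \<in> N v \<Longrightarrow> {v, u} \<in> E" "u \<in> N v \<Longrightarrow> {u, v} \<in> E"
  by (auto simp: nbrs_def insert_commute)

lemma N_sym: "u \<in> N v \<Longrightarrow> v \<in> N u"
  using nbrs_sym by metis

lemma N_V: "u \<in> N v \<Longrightarrow> u \<in> V"
  using edge_subset N_edge(1) by blast

lemma N_V': "u \<in> N v \<Longrightarrow> v \<in> V"
  using edge_subset N_edge(1) by blast

lemma N_irrefl: "v \<notin> N v"
  using simple by (auto simp: nbrs_def simple_graph_def)

lemma finite_N: "finite (N v)"
  using finite_subset[OF _ finite_V, of "N v"] N_V by blast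

lemma N_big_cases: "v \<in> V \<Longrightarrow> card (N v) = 2 \<or> 3 \<le> card (N v)"
  using deg_ge by force

lemma N_of_big: "3 \<le> card (N h) \<Longrightarrow> w \<in> N h \<Longrightarrow> card (N w) = 2"
  using sparse[of h w] N_edge by fastforce

lemma N_other:
  assumes "card (N w) = 2" "h \<in> N w"
  obtains z where "N w = {h, z}" "z \<noteq> h"
  using assms by (auto simp: card_2_iff doubleton_eq_iff)

lemma
  assumes "label_auto V E c f"
  shows auto_V: "v \<in> V \<Longrightarrow> f v \<in> V"
    and auto_inj: "u \<in> V \<Longrightarrow> v \<in> V \<Longrightarrow> f u = f v \<Longrightarrow> u = v"
    and auto_edge: "u \<in> V \<Longrightarrow> v \<in> V \<Longrightarrow> f u \<in> N (f v) \<longleftrightarrow> u \<in> N v"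
    and auto_label: "u \<in> N v \<Longrightarrow> c {f v, f u} = c {v, u}"
    and auto_N: "v \<in> V \<Longrightarrow> N (f v) = f ` N v"
    and auto_card: "v \<in> V \<Longrightarrow> card (N (f v)) = card (N v)"
proof -
  have bij: "bij_betw f V V" and ed: "\<And>u v. u \<in> V \<Longrightarrow> v \<in> V \<Longrightarrow> {u, v} \<in> E \<longleftrightarrow> {f u, f v} \<in> E"
    and lab: "\<And>e. e \<in> E \<Longrightarrow> c (f ` e) = c e"
    using assms by (auto simp: label_auto_def graph_iso_def)
  show 1: "f v \<in> V" if "v \<in> V" for v using that bij by (auto simp: bij_betw_def)
  show 2: "u = v" if "u \<in> V" "v \<in> V" "f u = f v" for u v
    using that bij by (auto simp: bij_betw_def inj_on_def)
  show 3: "f u \<in> N (f v) \<longleftrightarrow> u \<in> N v" if "u \<in> V" "v \<in> V" for u v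
    using that ed[of v u] by (simp add: nbrs_def)
  show "c {f v, f u} = c {v, u}" if "u \<in> N v" for u v
    using lab[OF N_edge(1)[OF that]] by simp
  show 4: "N (f v) = f ` N v" if v: "v \<in> V" for v
  proof
    show "N (f v) \<subseteq> f ` N v"
    proof
      fix y assume y: "y \<in> N (f v)"
      then have "y \<in> f ` V" using bij N_V by (auto simp: bij_betw_def)
      then obtain u where "u \<in> V" "y = f u" by auto
      then show "y \<in> f ` N v" using 3 v y by auto
    qed
    show "f ` N v \<subseteq> N (f v)" using 3 v N_V by auto
  qed
  show "card (N (f v)) = card (N v)" if v: "v \<in> V" for v
  proof -
    have "inj_on f (N v)" using 2 N_V by (meson inj_onI)
    then show ?thesis using 4[OF v] by (simp add: card_image)
  qed
qed

lemma boundary_edge: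
  assumes "S \<subseteq> V" "S \<noteq> {}" "S \<noteq> V"
  obtains v w where "v \<in> S" "w \<in> N v" "w \<notin> S"
proof -
  obtain a b where a: "a \<in> S" and b: "b \<in> V" "b \<notin> S" using assms by blast
  then have "(\<lambda>x y. {x, y} \<in> E)\<^sup>*\<^sup>* a b" using conn assms(1) by (auto simp: connected_graph_def)
  then have "\<exists>v\<in>S. \<exists>w. w \<in> N v \<and> w \<notin> S" using a b(2)
  proof (induction rule: rtranclp_induct)
    case (step y z)
    then show ?case by (cases "y \<in> S") (auto simp: nbrs_def)
  qed simp
  then show ?thesis using that by blast
qed

section \<open>Growing a rigid core\<close>

text \<open>The quantification over all \<open>c'\<close> agreeing with \<open>c\<close> inside
  \<open>S\<close> makes rigidity survive every later choice of labels outside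
  \<open>S\<close>.\<close>

definition rigid :: "'a set \<Rightarrow> 'a set \<Rightarrow> ('a set \<Rightarrow> nat) \<Rightarrow> bool" where
  "rigid S0 S c \<longleftrightarrow> (\<forall>c' f. (\<forall>e. e \<subseteq> S \<longrightarrow> c' e = c e) \<longrightarrow> label_auto V E c' f \<longrightarrow>
     (\<forall>v\<in>S0. f v = v) \<longrightarrow> (\<forall>v\<in>S. f v = v))"

text \<open>
  The last condition says that the growth never stops halfway along a path of length 2 between two
  vertices of degree at least 3, or inside a triangle; the labels of these are chosen in one step.
\<close>

definition closed_core :: "'a set \<Rightarrow> bool" where
  "closed_core S \<longleftrightarrow> S \<subseteq> V \<and> (\<forall>v\<in>S. \<exists>u\<in>N v. u \<in> S) \<and>
     (\<forall>w\<in>S. card (N w) = 2 \<and> \<not> N w \<subseteq> S \<longrightarrow> (\<exists>a b. N w = {a, b} \<and> card (N a) = 2 \<and> b \<notin> N a))"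

text \<open>
  Paths of length 2 need not be oriented away from the core, so only one of their two directions
  is known to avoid the reserved pair \<open>(r, 0)\<close>.
\<close>

definition reserved_path2 :: "nat \<Rightarrow> 'a set \<Rightarrow> 'a set \<Rightarrow> ('a set \<Rightarrow> nat) \<Rightarrow> bool" where
  "reserved_path2 r S0 S c \<longleftrightarrow> (\<forall>w\<in>S. \<forall>h z. w \<notin> S0 \<and> N w = {h, z} \<and> 3 \<le> card (N h) \<and> 3 \<le> card (N z) \<longrightarrow>
     (c {h, w}, c {w, z}) \<noteq> (r, 0) \<or> (c {z, w}, c {w, h}) \<noteq> (r, 0))"

text \<open>With \<open>z\<close> of degree 2 these paths have a natural direction. The alternative
  \<open>c {h, w} = 0\<close> admits paths that the growth entered from the side of
  \<open>z\<close>, where \<open>{h, w}\<close> gets the default label; for \<open>r = 1\<close>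
  these cannot be confused with a path labeled \<open>(r, 0)\<close> either.\<close>

definition reserved_path3 :: "nat \<Rightarrow> 'a set \<Rightarrow> 'a set \<Rightarrow> ('a set \<Rightarrow> nat) \<Rightarrow> bool" where
  "reserved_path3 r S0 S c \<longleftrightarrow> (\<forall>h w z. 3 \<le> card (N h) \<and> N w = {h, z} \<and> card (N z) = 2 \<and> z \<notin> N h \<and>
     {h, w} \<subseteq> S \<and> \<not> {h, w} \<subseteq> S0 \<longrightarrow> c {h, w} = 0 \<or> z \<in> S \<and> (c {h, w}, c {w, z}) \<noteq> (r, 0))"

text \<open>The pattern 0, 1, 1 plays for triangles the role that \<open>(r, 0)\<close> plays for
  paths.\<close>

definition reserved_triangle :: "'a set \<Rightarrow> 'a set \<Rightarrow> ('a set \<Rightarrow> nat) \<Rightarrow> bool" where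
  "reserved_triangle S0 S c \<longleftrightarrow> (\<forall>h w z. 3 \<le> card (N h) \<and> N w = {h, z} \<and> N z = {h, w} \<and> w \<in> S \<and> w \<notin> S0 \<longrightarrow>
     \<not> (c {h, w} = 0 \<and> c {h, z} = 1 \<and> c {w, z} = 1))"

text \<open>The invariant of the growth. The label bound ranges over all of \<open>E\<close> because
  labels outside \<open>S\<close> are present but provisional.\<close>

definition grown :: "nat \<Rightarrow> 'a set \<Rightarrow> ('a set \<Rightarrow> nat) \<Rightarrow> 'a set \<Rightarrow> ('a set \<Rightarrow> nat) \<Rightarrow> bool" where
  "grown r S0 c0 S c \<longleftrightarrow> S0 \<subseteq> S \<and> (\<forall>e. e \<subseteq> S0 \<longrightarrow> c e = c0 e) \<and> (\<forall>e\<in>E. c e < k) \<and>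
     closed_core S \<and> rigid S0 S c \<and> reserved_path2 r S0 S c \<and> reserved_path3 r S0 S c \<and>
     reserved_triangle S0 S c"

text \<open>One of the two neighbours of \<open>v\<close> is already fixed, so the other one is
  fixed too, whatever the labels are. Hence all new labels can be 0, which none of the reservations
  forbids.\<close>

lemma grow_at_degree_2:
  assumes g: "grown r S0 c0 S c" and v: "v \<in> S" "card (N v) = 2" "\<not> N v \<subseteq> S"
  shows "\<exists>S' c'. S \<subset> S' \<and> grown r S0 c0 S' c'"
proof -
  from g have S0: "S0 \<subseteq> S" and c0: "\<And>e. e \<subseteq> S0 \<Longrightarrow> c e = c0 e" and ck: "\<And>e. e \<in> E \<Longrightarrow> c e < k"
    and cl: "closed_core S" and ri: "rigid S0 S c" and p2: "reserved_path2 r S0 S c"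
    and p3: "reserved_path3 r S0 S c" and tr: "reserved_triangle S0 S c"
    by (auto simp: grown_def)
  have SV: "S \<subseteq> V" using cl by (simp add: closed_core_def)
  obtain u where u: "u \<in> N v" "u \<in> S" using cl v(1) unfolding closed_core_def by blast
  obtain w where Nv: "N v = {u, w}" "w \<noteq> u" using N_other[OF v(2) u(1)] by metis
  have wS: "w \<notin> S" using v u Nv by auto
  \<comment> \<open>The last clause of \<open>closed_core\<close> ensures that
    \<open>u, v, w\<close> is not a triangle.\<close>
  have "\<exists>a b. N v = {a, b} \<and> card (N a) = 2 \<and> b \<notin> N a"
    using cl v by (auto simp: closed_core_def)
  then have uw: "u \<notin> N w" "w \<notin> N u"
    using Nv N_sym by (auto simp: doubleton_eq_iff)
  have wV: "w \<in> V" using N_V Nv by blast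
  have vw: "v \<in> N w" "w \<in> N v" using Nv N_sym by auto
  define S' where "S' = insert w S"
  define c' where "c' = (\<lambda>e. if e \<subseteq> S then c e else (0::nat))"
  have c'S: "e \<subseteq> S \<Longrightarrow> c' e = c e" for e by (simp add: c'_def)
  have "closed_core S'"
    unfolding closed_core_def
  proof (intro conjI ballI impI)
    show "S' \<subseteq> V" using SV wV by (auto simp: S'_def)
    show "\<exists>u\<in>N x. u \<in> S'" if "x \<in> S'" for x
      using that cl vw v(1) by (auto simp: S'_def closed_core_def)
    fix x assume x: "x \<in> S'" and *: "card (N x) = 2 \<and> \<not> N x \<subseteq> S'"
    show "\<exists>a b. N x = {a, b} \<and> card (N a) = 2 \<and> b \<notin> N a"
    proof (cases "x \<in> S")
      case True
      then show ?thesis using cl * by (auto simp: closed_core_def S'_def)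
    next
      case False
      then have [simp]: "x = w" using x by (simp add: S'_def)
      obtain y where y: "N w = {v, y}" "y \<noteq> v" using N_other * vw by (metis \<open>x = w\<close>)
      have "y \<notin> N v"
        using y(1) Nv(1) uw N_irrefl[of w] by (metis insertCI insertE singletonD)
      then show ?thesis using y v(2) by auto
    qed
  qed
  moreover have "rigid S0 S' c'"
    unfolding rigid_def
  proof (intro allI impI)
    fix d f assume d: "\<forall>e. e \<subseteq> S' \<longrightarrow> d e = c' e" and f: "label_auto V E d f"
      and f0: "\<forall>v\<in>S0. f v = v"
    have "\<forall>e. e \<subseteq> S \<longrightarrow> d e = c e" using d c'S by (auto simp: S'_def)
    then have fS: "\<forall>v\<in>S. f v = v" using ri f f0 by (auto simp: rigid_def)
    have "f w \<in> N (f v)" using auto_edge[OF f, of w v] wV vw SV v(1) by auto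
    then have "f w \<in> {u, w}" using fS v(1) Nv by auto
    moreover have "f w \<noteq> u" using auto_inj[OF f, of w u] fS u(2) wV SV Nv(2) by auto
    ultimately show "\<forall>v\<in>S'. f v = v" using fS by (auto simp: S'_def)
  qed
  moreover have "reserved_path2 r S0 S' c'"
    unfolding reserved_path2_def
  proof (intro ballI allI impI)
    fix x h z assume x: "x \<in> S'" and *: "x \<notin> S0 \<and> N x = {h, z} \<and> 3 \<le> card (N h) \<and> 3 \<le> card (N z)"
    \<comment> \<open>The new vertex has the neighbour \<open>v\<close> of degree 2, so it is not
      the middle of a path between two vertices of degree at least 3.\<close>
    have "x \<noteq> w" using * vw v(2) by auto
    then have xS: "x \<in> S" using x by (simp add: S'_def)
    have "h \<noteq> z" using deg_ge[of x] xS SV * by (auto dest: subsetD)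
    then have "card (N x) = 2" using * by simp
    have "N x \<subseteq> S"
    proof (rule ccontr)
      assume "\<not> N x \<subseteq> S"
      then obtain a b where "N x = {a, b}" "card (N a) = 2"
        using cl xS \<open>card (N x) = 2\<close> unfolding closed_core_def by blast
      then show False using * by (auto simp: doubleton_eq_iff)
    qed
    then have "c' {h, x} = c {h, x}" "c' {x, z} = c {x, z}" "c' {z, x} = c {z, x}" "c' {x, h} = c {x, h}"
      using * xS by (auto intro!: c'S)
    then show "(c' {h, x}, c' {x, z}) \<noteq> (r, 0) \<or> (c' {z, x}, c' {x, h}) \<noteq> (r, 0)"
      using p2 * xS unfolding reserved_path2_def by metis
  qed
  moreover have "reserved_path3 r S0 S' c'"
    unfolding reserved_path3_def
  proof (intro allI impI)
    fix h x z assume *: "3 \<le> card (N h) \<and> N x = {h, z} \<and> card (N z) = 2 \<and> z \<notin> N h \<and>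
     {h, x} \<subseteq> S' \<and> \<not> {h, x} \<subseteq> S0"
    show "c' {h, x} = 0 \<or> z \<in> S' \<and> (c' {h, x}, c' {x, z}) \<noteq> (r, 0)"
    proof (cases "{h, x} \<subseteq> S")
      case True
      then have "c {h, x} = 0 \<or> z \<in> S \<and> (c {h, x}, c {x, z}) \<noteq> (r, 0)"
        using p3 * unfolding reserved_path3_def by metis
      then show ?thesis using True c'S by (auto simp: S'_def)
    next
      case False
      then have "c' {h, x} = 0" unfolding c'_def by (rule if_not_P)
      then show ?thesis by simp
    qed
  qed
  moreover have "reserved_triangle S0 S' c'"
    unfolding reserved_triangle_def
  proof (intro allI impI)
    fix h x z assume *: "3 \<le> card (N h) \<and> N x = {h, z} \<and> N z = {h, x} \<and> x \<in> S' \<and> x \<notin> S0"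
    have hz: "z \<in> N h" "h \<in> N z" using * N_sym[of h z] by auto
    have "h \<noteq> z" using hz N_irrefl by auto
    then have c2: "card (N x) = 2" using * by auto
    \<comment> \<open>If \<open>w\<close> were in such a triangle, its neighbour \<open>v\<close> of
      degree 2 would be \<open>z\<close>, hence \<open>u\<close> would be \<open>h\<close>, and
      \<open>u\<close> and \<open>w\<close> would be adjacent.\<close>
    have "x \<noteq> w"
    proof
      assume [simp]: "x = w"
      have "v = z" using vw(1) * v(2) by auto
      then show False using * Nv uw N_sym by (auto simp: doubleton_eq_iff)
    qed
    then have xS: "x \<in> S" using * by (simp add: S'_def)
    have "N x \<subseteq> S"
    proof (rule ccontr)
      assume "\<not> N x \<subseteq> S"
      then obtain a b where "N x = {a, b}" "b \<notin> N a"
        using cl xS c2 unfolding closed_core_def by blast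
      then show False using hz * by (auto simp: doubleton_eq_iff)
    qed
    then have "c' {h, x} = c {h, x}" "c' {h, z} = c {h, z}" "c' {x, z} = c {x, z}"
      using * xS by (auto intro!: c'S)
    then show "\<not> (c' {h, x} = 0 \<and> c' {h, z} = 1 \<and> c' {x, z} = 1)"
      using tr * xS unfolding reserved_triangle_def by metis
  qed
  moreover have "\<forall>e. e \<subseteq> S0 \<longrightarrow> c' e = c0 e" using c0 c'S S0 by auto
  moreover have "\<forall>e\<in>E. c' e < k" using ck k_ge by (auto simp: c'_def)
  ultimately have "grown r S0 c0 S' c'" using S0 unfolding grown_def by (auto simp: S'_def)
  moreover have "S \<subset> S'" using wS by (auto simp: S'_def)
  ultimately show ?thesis by blast
qed

lemma inj_into_finite:
  assumes "finite A" "finite B" "card A \<le> card B"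
  obtains f where "inj_on f A" "f ` A \<subseteq> B"
  using card_le_inj[OF assms] by blast

text \<open>As \<open>h\<close> is fixed, its neighbours \<open>w\<close> outside \<open>S\<close>
  can only be permuted among themselves, so it suffices to give them different signatures: the
  labels along the path \<open>h, w, p w\<close>, or those of all three edges if this path closes to
  a triangle. Treating vertices of degree 2 first (\<open>closed2\<close>) guarantees that no
  triangle at \<open>h\<close> lies partly outside \<open>S\<close> with one of its degree-2
  vertices inside.\<close>

lemma grow_at_big:
  assumes g: "grown r S0 c0 S c" and r: "r < k"
    and closed2: "\<And>v. v \<in> S \<Longrightarrow> card (N v) = 2 \<Longrightarrow> N v \<subseteq> S"
    and h: "h \<in> S" "3 \<le> card (N h)" "\<not> N h \<subseteq> S"
  shows "\<exists>S' c'. S \<subset> S' \<and> grown r S0 c0 S' c'"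
proof -
  from g have S0: "S0 \<subseteq> S" and c0: "\<And>e. e \<subseteq> S0 \<Longrightarrow> c e = c0 e" and ck: "\<And>e. e \<in> E \<Longrightarrow> c e < k"
    and cl: "closed_core S" and ri: "rigid S0 S c" and p2: "reserved_path2 r S0 S c"
    and p3: "reserved_path3 r S0 S c" and tr: "reserved_triangle S0 S c"
    by (auto simp: grown_def)
  have SV: "S \<subseteq> V" using cl by (simp add: closed_core_def)
  define W where "W = N h - S"
  have hV: "h \<in> V" using h SV by auto
  have W2: "card (N w) = 2" if "w \<in> W" for w using N_of_big[OF h(2)] that by (simp add: W_def)
  have hW: "h \<in> N w" "w \<in> N h" "w \<notin> S" "w \<in> V" "w \<noteq> h" if "w \<in> W" for w
    using that N_sym N_V h(1) by (auto simp: W_def)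
  have "\<exists>z. N w = {h, z} \<and> z \<noteq> h" if "w \<in> W" for w
    using N_other[OF W2 hW(1)] that by metis
  then obtain p where p: "\<And>w. w \<in> W \<Longrightarrow> N w = {h, p w}" "\<And>w. w \<in> W \<Longrightarrow> p w \<noteq> h" by metis
  have pN: "w \<in> N (p w)" "p w \<in> N w" "p w \<in> V" "p w \<noteq> w" if "w \<in> W" for w
  proof -
    show pw: "p w \<in> N w" by (simp add: p(1)[OF that])
    show "w \<in> N (p w)" "p w \<in> V" using N_sym[OF pw] N_V[OF pw] .
    show "p w \<noteq> w" using pw N_irrefl by metis
  qed
  have finW: "finite W" using finite_N by (simp add: W_def)
  have cardW: "card W \<le> k\<^sup>2 - 1"
  proof -
    \<comment> \<open>This neighbour inside the core is what saves the one pair of labels that is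
      kept in reserve.\<close>
    obtain u where u: "u \<in> N h" "u \<in> S" using cl h unfolding closed_core_def by blast
    have "card W \<le> card (N h - {u})"
      by (rule card_mono) (use u finite_N in \<open>auto simp: W_def\<close>)
    also have "\<dots> = card (N h) - 1" using u by simp
    finally show ?thesis using deg_le[OF hV] by simp
  qed
  define T where "T = {w \<in> W. p w \<in> N h}"
  have TW: "T \<subseteq> W" by (auto simp: T_def)
  have pT: "p w \<in> T" "p (p w) = w" if w: "w \<in> T" for w
  proof -
    have wW: "w \<in> W" using w TW by auto
    have "card (N (p w)) = 2" using w h(2) N_of_big by (auto simp: T_def)
    then have "p w \<notin> S" using closed2 pN(1)[OF wW] hW(3)[OF wW] by auto
    then have pW: "p w \<in> W" using w by (auto simp: T_def W_def)
    show pp: "p (p w) = w" using pN(1)[OF wW] p(1)[OF pW] hW(5)[OF wW] by auto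
    show "p w \<in> T" using pW pp wW hW by (auto simp: T_def)
  qed
  have pWT: "w \<in> T" if "w \<in> W" "p w \<in> W" for w
    using that hW by (auto simp: T_def)
  \<comment> \<open>A numbering of the vertices selects one vertex of each triangle pair
    \<open>{w, p w}\<close>; the selected ones form \<open>T1\<close>.\<close>
  obtain \<iota> :: "'a \<Rightarrow> nat" where \<iota>: "inj_on \<iota> V"
    using finite_imp_inj_to_nat_seg[OF finite_V] by blast
  define T1 where "T1 = {w \<in> T. \<iota> w < \<iota> (p w)}"
  have T1T: "T1 \<subseteq> T" by (auto simp: T1_def)
  have T1p: "w \<in> T1 \<longleftrightarrow> p w \<notin> T1" if w: "w \<in> T" for w
  proof -
    have "w \<in> W" using w TW by auto
    then have "\<iota> w \<noteq> \<iota> (p w)" using inj_onD[OF \<iota>, of w "p w"] hW(4) pN(3,4) by metis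
    then show ?thesis using w pT[OF w] by (auto simp: T1_def)
  qed
  obtain f where f: "inj_on f (W - T)" "f ` (W - T) \<subseteq> {..<k} \<times> {..<k} - {(r, 0::nat)}"
  proof (rule inj_into_finite)
    have "card ({..<k} \<times> {..<k} - {(r, 0::nat)}) = k\<^sup>2 - 1"
      using r by (simp add: card_cartesian_product power2_eq_square)
    moreover have "card (W - T) \<le> card W" using finW by (simp add: card_mono)
    ultimately show "card (W - T) \<le> card ({..<k} \<times> {..<k} - {(r, 0::nat)})" using cardW by simp
  qed (use finW in auto)
  \<comment> \<open>For \<open>w\<close> in \<open>T1\<close> the triangle gets 0 on
    \<open>{h, w}\<close>, \<open>fst (q w)\<close> on \<open>{h, p w}\<close> and
    \<open>snd (q w)\<close> on \<open>{w, p w}\<close>. A nonzero first component breaks the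
    symmetry between \<open>w\<close> and \<open>p w\<close>; excluding \<open>(1, 1)\<close> avoids
    the reserved pattern.\<close>
  obtain q where q: "inj_on q T1" "q ` T1 \<subseteq> {1..<k} \<times> {..<k} - {(1, 1::nat)}"
  proof (rule inj_into_finite)
    have fin: "finite T1" using finW TW T1T by (meson finite_subset)
    have "card (T1 \<union> p ` T1) = card T1 + card (p ` T1)"
      using fin T1p T1T by (intro card_Un_disjoint) auto
    also have "card (p ` T1) = card T1"
      by (rule card_image) (metis T1T inj_onI pT(2) subsetD)
    finally have "2 * card T1 = card (T1 \<union> p ` T1)" by simp
    also have "\<dots> \<le> card W"
      by (rule card_mono) (use finW TW T1T pT in auto)
    finally have "2 * card T1 \<le> k\<^sup>2 - 1" using cardW by simp
    \<comment> \<open>Equality holds for \<open>k = 2\<close>. The summand 1 does no harm because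
      \<open>2 * card T1\<close> is even.\<close>
    moreover have "k\<^sup>2 - 1 \<le> 2 * ((k - 1) * k - 1) + 1"
    proof -
      obtain j where "k = j + 2" using k_ge by (metis add.commute le_Suc_ex)
      then show ?thesis by (simp add: power2_eq_square algebra_simps)
    qed
    moreover have "card ({1..<k} \<times> {..<k} - {(1, 1::nat)}) = (k - 1) * k - 1"
      using k_ge by (simp add: card_cartesian_product)
    ultimately show "card T1 \<le> card ({1..<k} \<times> {..<k} - {(1, 1::nat)})" by linarith
  qed (use finW TW T1T in \<open>auto intro: finite_subset\<close>)
  define L1 where "L1 = (\<lambda>w. if w \<in> T1 then 0 else if w \<in> T then fst (q (p w)) else fst (f w))"
  define L2 where "L2 = (\<lambda>w. if w \<in> T1 then snd (q w) else if w \<in> T then snd (q (p w)) else snd (f w))"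
  have qT1: "1 \<le> fst (q w)" "fst (q w) < k" "snd (q w) < k" "q w \<noteq> (1, 1)" if "w \<in> T1" for w
    using q(2) that by (auto simp: image_subset_iff mem_Times_iff)
  have fW: "fst (f w) < k" "snd (f w) < k" "f w \<noteq> (r, 0)" if "w \<in> W - T" for w
  proof -
    have "f w \<in> {..<k} \<times> {..<k} - {(r, 0::nat)}" using f(2) that by blast
    then show "fst (f w) < k" "snd (f w) < k" "f w \<noteq> (r, 0)" by auto
  qed
  have L1k: "L1 w < k" and L2k: "L2 w < k" if "w \<in> W" for w
    using that k_ge qT1(2,3)[of w] qT1(2,3)[of "p w"] fW[of w] T1p[of w] by (auto simp: L1_def L2_def)
  have Lreg: "(L1 w, L2 w) = f w" if "w \<notin> T" for w
    using that T1T by (auto simp: L1_def L2_def)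
  have L2p: "L2 (p w) = L2 w" if "w \<in> T" for w
    using that pT[OF that] T1p[OF that] T1T by (auto simp: L2_def)
  have L0: "w \<in> T1 \<longleftrightarrow> L1 w = 0" if "w \<in> T" for w
    using that qT1(1)[of "p w"] T1p[of w] by (auto simp: L1_def)
  \<comment> \<open>In a triangle \<open>L1 w\<close> and \<open>L2 w\<close> alone may miss one
    component of \<open>q\<close>: for \<open>w\<close> in \<open>T1\<close> the first component
    sits on the partner's edge, so \<open>L1 (p w)\<close> belongs to the signature.\<close>
  have signature: "w = w'" if w: "w \<in> W" "w' \<in> W" and eq: "L1 w = L1 w'" "L2 w = L2 w'" "w \<in> T \<longleftrightarrow> w' \<in> T"
    "w \<in> T \<Longrightarrow> L1 (p w) = L1 (p w')" for w w'
  proof (cases "w \<in> T")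
    case False
    then have "f w = f w'" using eq(1-3) Lreg[of w] Lreg[of w'] by simp
    then show ?thesis using inj_onD[OF f(1)] w False eq(3) by auto
  next
    case T: True
    then have T': "w' \<in> T" using eq by simp
    show ?thesis
    proof (cases "w \<in> T1")
      case True
      then have T1': "w' \<in> T1" using L0 T T' eq(1) by metis
      have "q w = q w'"
        using eq(2) eq(4)[OF T] True T1' T1p[OF T] T1p[OF T'] pT[OF T] pT[OF T']
        by (auto simp: L1_def L2_def prod_eq_iff)
      then show ?thesis using inj_onD[OF q(1)] True T1' by auto
    next
      case False
      then have T1': "w' \<notin> T1" using L0 T T' eq(1) by metis
      have "q (p w) = q (p w')"
        using eq(1,2) False T1' T T' by (auto simp: L1_def L2_def prod_eq_iff)
      then have "p w = p w'" using inj_onD[OF q(1)] False T1' T1p[OF T] T1p[OF T'] by auto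
      then show ?thesis using pT[OF T] pT[OF T'] by metis
    qed
  qed
  define S' where "S' = S \<union> W \<union> p ` W"
  \<comment> \<open>On the third edge of a triangle \<open>SOME\<close> may pick either end, but
    both have the same \<open>L2\<close> by \<open>L2p\<close>. Sets outside \<open>S\<close> that
    miss \<open>W\<close> get the default label 0.\<close>
  define c' where "c' = (\<lambda>e. if e \<subseteq> S then c e else if h \<in> e \<and> e \<inter> W \<noteq> {} then L1 (the_elem (e - {h}))
    else if e \<inter> W \<noteq> {} then L2 (SOME w. w \<in> e \<inter> W) else (0::nat))"
  have c'S: "c' e = c e" if "e \<subseteq> S" for e unfolding c'_def by (rule if_P[OF that])
  have c'h: "c' {h, w} = L1 w" "c' {w, h} = L1 w" if "w \<in> W" for w
  proof -
    have "\<not> {h, w} \<subseteq> S" "{h, w} - {h} = {w}" "h \<in> {h, w}" "{h, w} \<inter> W \<noteq> {}"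
      using hW[OF that] that by auto
    then show "c' {h, w} = L1 w" by (simp only: c'_def if_False if_True the_elem_eq simp_thms)
    then show "c' {w, h} = L1 w" by (simp add: insert_commute)
  qed
  have c'p: "c' {w, p w} = L2 w" "c' {p w, w} = L2 w" if w: "w \<in> W" for w
  proof -
    have 1: "\<not> {w, p w} \<subseteq> S" "h \<notin> {w, p w}" "{w, p w} \<inter> W \<noteq> {}" using hW[OF w] p(2)[OF w] w by auto
    have "(SOME x. x \<in> {w, p w} \<inter> W) \<in> {w, p w} \<inter> W"
      by (rule someI_ex) (use 1(3) in blast)
    then have "L2 (SOME x. x \<in> {w, p w} \<inter> W) = L2 w" using pWT[OF w] L2p by auto
    then show "c' {w, p w} = L2 w" using 1 by (simp only: c'_def if_False if_True simp_thms)
    then show "c' {p w, w} = L2 w" by (simp add: insert_commute)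
  qed
  have c'0: "c' e = 0" if "\<not> e \<subseteq> S" "e \<inter> W = {}" for e
    using that by (simp add: c'_def)
  have c'k: "c' e < k" if e: "e \<in> E" for e
  proof (cases "e \<subseteq> S \<or> e \<inter> W = {}")
    case True
    then show ?thesis using ck[OF e] c'S c'0 k_ge by (metis gr_zeroI leD order_less_le_trans zero_less_numeral)
  next
    case False
    then obtain w where w: "w \<in> e" "w \<in> W" by auto
    obtain a b where ab: "e = {a, b}" "a \<in> N b" "b \<in> N a" using edge_cases[OF e] by metis
    then have "e = {w, h} \<or> e = {w, p w}" using w p(1)[OF w(2)] by (auto simp: insert_commute)
    then show ?thesis using c'h(2)[OF w(2)] c'p(1)[OF w(2)] L1k[OF w(2)] L2k[OF w(2)] by metis
  qed
  have "closed_core S'"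
    unfolding closed_core_def
  proof (intro conjI ballI impI)
    show "S' \<subseteq> V" using SV hW pN by (auto simp: S'_def)
    show "\<exists>u\<in>N x. u \<in> S'" if x: "x \<in> S'" for x
    proof -
      consider "x \<in> S" | "x \<in> W" | "x \<in> p ` W" using x by (auto simp: S'_def)
      then show ?thesis
      proof cases
        case 1 then show ?thesis using cl unfolding S'_def closed_core_def by blast
      next
        case 2 then show ?thesis using hW h(1) by (auto simp: S'_def)
      next
        case 3 then show ?thesis using pN by (auto simp: S'_def)
      qed
    qed
    fix x assume x: "x \<in> S'" and *: "card (N x) = 2 \<and> \<not> N x \<subseteq> S'"
    \<comment> \<open>Vertices of \<open>W\<close> have both neighbours \<open>h\<close> and
      \<open>p w\<close> in \<open>S'\<close>, so a vertex of degree 2 that still has a neighbour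
      outside must be some \<open>p w\<close>.\<close>
    have "x \<notin> S" using * closed2[of x] by (auto simp: S'_def)
    moreover have "x \<notin> W" using * p(1)[of x] h(1) by (auto simp: S'_def)
    ultimately obtain w where w: "w \<in> W" "x = p w" using x by (auto simp: S'_def)
    then obtain y where y: "N x = {w, y}" "y \<noteq> w" using N_other * pN(1) by metis
    have "y \<notin> N w"
    proof
      assume "y \<in> N w"
      moreover have "y \<noteq> x" using y N_irrefl by auto
      ultimately have "y = h" using p(1)[OF w(1)] w by auto
      then show False using * y w h(1) by (auto simp: S'_def)
    qed
    then show "\<exists>a b. N x = {a, b} \<and> card (N a) = 2 \<and> b \<notin> N a" using y W2[OF w(1)] by auto
  qed
  moreover have "rigid S0 S' c'"
    unfolding rigid_def
  proof (intro allI impI)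
    fix d \<phi> assume d: "\<forall>e. e \<subseteq> S' \<longrightarrow> d e = c' e" and \<phi>: "label_auto V E d \<phi>"
      and \<phi>0: "\<forall>v\<in>S0. \<phi> v = v"
    have "\<forall>e. e \<subseteq> S \<longrightarrow> d e = c e" using d c'S by (auto simp: S'_def)
    then have \<phi>S: "\<forall>v\<in>S. \<phi> v = v" using ri \<phi> \<phi>0 unfolding rigid_def by blast
    have dh: "d {h, w} = L1 w" and dp: "d {w, p w} = L2 w" if "w \<in> W" for w
      using d c'h c'p that h(1) by (auto simp: S'_def)
    have \<phi>W: "\<phi> w \<in> W" if w: "w \<in> W" for w
    proof -
      have "\<phi> w \<in> N h" using auto_edge[OF \<phi>, of w h] hW[OF w] hV \<phi>S h(1) by auto
      moreover have "\<phi> w \<notin> S" using auto_inj[OF \<phi>, of "\<phi> w" w] auto_V[OF \<phi>] hW[OF w] \<phi>S SV by auto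
      ultimately show ?thesis by (simp add: W_def)
    qed
    have \<phi>p: "\<phi> (p w) = p (\<phi> w)" if w: "w \<in> W" for w
    proof -
      have "{h, p (\<phi> w)} = {h, \<phi> (p w)}"
        using auto_N[OF \<phi>, of w] hW(4)[OF w] p(1)[OF w] p(1)[OF \<phi>W[OF w]] \<phi>S h(1) by auto
      then show ?thesis using p(2)[OF \<phi>W[OF w]] by (auto simp: doubleton_eq_iff)
    qed
    have \<phi>1: "L1 (\<phi> w) = L1 w" if w: "w \<in> W" for w
      using auto_label[OF \<phi>, of w h] hW[OF w] dh[OF w] dh[OF \<phi>W[OF w]] \<phi>S h(1) by auto
    have \<phi>2: "L2 (\<phi> w) = L2 w" if w: "w \<in> W" for w
      using auto_label[OF \<phi>, of "p w" w] pN[OF w] dp[OF w] dp[OF \<phi>W[OF w]] \<phi>p[OF w] by auto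
    have \<phi>T: "w \<in> T \<longleftrightarrow> \<phi> w \<in> T" if w: "w \<in> W" for w
      using auto_edge[OF \<phi>, of "p w" h] w \<phi>W[OF w] \<phi>p[OF w] pN(3)[OF w] hV \<phi>S h(1) by (auto simp: T_def)
    have \<phi>id: "\<phi> w = w" if w: "w \<in> W" for w
    proof (rule signature)
      assume "\<phi> w \<in> T"
      then have "w \<in> T" using \<phi>T w by auto
      then have "p w \<in> W" using pT TW by auto
      then show "L1 (p (\<phi> w)) = L1 (p w)" using \<phi>1 \<phi>p[OF w] by metis
    qed (use \<phi>W \<phi>1 \<phi>2 \<phi>T w in auto)
    then have "\<phi> (p w) = p w" if "w \<in> W" for w using \<phi>p[OF that] \<phi>id[OF that] by simp
    then show "\<forall>v\<in>S'. \<phi> v = v" using \<phi>id \<phi>S by (auto simp: S'_def)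
  qed
  moreover have "reserved_path2 r S0 S' c'"
    unfolding reserved_path2_def
  proof (intro ballI allI impI)
    fix x a b assume x: "x \<in> S'" and *: "x \<notin> S0 \<and> N x = {a, b} \<and> 3 \<le> card (N a) \<and> 3 \<le> card (N b)"
    have "x \<notin> p ` W"
    proof
      assume "x \<in> p ` W"
      then obtain w where "w \<in> W" "w \<in> N x" using pN(1) by auto
      then show False using * W2[of w] by auto
    qed
    then consider "x \<in> S" | "x \<in> W" using x by (auto simp: S'_def)
    then show "(c' {a, x}, c' {x, b}) \<noteq> (r, 0) \<or> (c' {b, x}, c' {x, a}) \<noteq> (r, 0)"
    proof cases
      case 1
      have "card (N x) = 2" using * N_of_big[of a x] N_sym[of a x] by auto
      then have "N x \<subseteq> S" using closed2 1 by auto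
      then have "c' {a, x} = c {a, x}" "c' {x, b} = c {x, b}" "c' {b, x} = c {b, x}" "c' {x, a} = c {x, a}"
        using * 1 by (auto intro!: c'S)
      then show ?thesis using p2 * 1 unfolding reserved_path2_def by metis
    next
      case 2
      \<comment> \<open>A vertex with two neighbours of degree at least 3 is in no triangle at
        \<open>h\<close>, so its pair, read from \<open>h\<close>, is a value of \<open>f\<close>
        and differs from \<open>(r, 0)\<close>.\<close>
      have "x \<notin> T"
      proof
        assume "x \<in> T"
        then have "p x \<in> W" using pT TW by auto
        then show False using * W2[of "p x"] pN(2)[OF 2] by auto
      qed
      then have "(L1 x, L2 x) \<noteq> (r, 0)" using fW(3)[of x] 2 Lreg by simp
      moreover have "{a, b} = {h, p x}" using * p(1)[OF 2] by auto
      then have "a = h \<and> b = p x \<or> a = p x \<and> b = h" by (auto simp: doubleton_eq_iff)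
      ultimately show ?thesis using c'h[OF 2] c'p[OF 2] by auto
    qed
  qed
  moreover have "reserved_path3 r S0 S' c'"
    unfolding reserved_path3_def
  proof (intro allI impI)
    fix a x b assume *: "3 \<le> card (N a) \<and> N x = {a, b} \<and> card (N b) = 2 \<and> b \<notin> N a \<and>
     {a, x} \<subseteq> S' \<and> \<not> {a, x} \<subseteq> S0"
    have bh: "b \<noteq> h" using * h(2) by auto
    consider "{a, x} \<subseteq> S" | "\<not> {a, x} \<subseteq> S" "a = h" | "\<not> {a, x} \<subseteq> S" "a \<noteq> h" by blast
    then show "c' {a, x} = 0 \<or> b \<in> S' \<and> (c' {a, x}, c' {x, b}) \<noteq> (r, 0)"
    proof cases
      case 1
      then have "c {a, x} = 0 \<or> b \<in> S \<and> (c {a, x}, c {x, b}) \<noteq> (r, 0)"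
        using p3 * unfolding reserved_path3_def by metis
      moreover have "c' {x, b} = c {x, b}" if "b \<in> S" using that 1 c'S by auto
      ultimately show ?thesis using c'S[OF 1] by (auto simp: S'_def)
    next
      case 2
      then have xW: "x \<in> W" using * h(1) N_sym[of a x] by (auto simp: W_def)
      then have px: "p x = b" using p[OF xW] * 2 by (auto simp: doubleton_eq_iff)
      then have "x \<notin> T" using * 2 by (auto simp: T_def)
      then have "(L1 x, L2 x) \<noteq> (r, 0)" using fW(3)[of x] xW Lreg by simp
      then show ?thesis using c'h[OF xW] c'p[OF xW] px 2 xW by (auto simp: S'_def)
    next
      \<comment> \<open>A new edge of this kind at a vertex other than \<open>h\<close> misses
        \<open>W\<close> and therefore has the default label 0.\<close>
      case 3
      have "x \<notin> W" using p(1)[of x] * bh 3 by (auto simp: doubleton_eq_iff)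
      moreover have "a \<notin> W" using W2[of a] * by auto
      ultimately show ?thesis using c'0[OF 3(1)] by auto
    qed
  qed
  moreover have "reserved_triangle S0 S' c'"
    unfolding reserved_triangle_def
  proof (intro allI impI)
    fix a x b assume *: "3 \<le> card (N a) \<and> N x = {a, b} \<and> N b = {a, x} \<and> x \<in> S' \<and> x \<notin> S0"
    have Nx: "N x = {a, b}" and Nb: "N b = {a, x}" and xS': "x \<in> S'" using * by simp_all
    have ab: "a \<in> N b" "a \<in> N x" unfolding Nx Nb by (rule insertI1)+
    note ab = ab(2) N_sym[OF ab(1)] N_sym[OF ab(2)]
    have x2: "card (N x) = 2" "card (N b) = 2"
      using N_of_big[OF conjunct1[OF *] ab(3)] N_of_big[OF conjunct1[OF *] ab(2)] .
    \<comment> \<open>If \<open>x\<close> is some \<open>p w\<close>, then \<open>w\<close> is the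
      other vertex \<open>b\<close> of degree 2, so the apex \<open>a\<close> is \<open>h\<close>
      and \<open>x\<close> is itself in \<open>W\<close>.\<close>
    have "x \<in> S \<or> x \<in> W"
    proof (cases "x \<in> S \<union> W")
      case False
      then obtain w where w: "w \<in> W" "x = p w" using xS' by (auto simp: S'_def)
      then have "w \<in> {a, b}" using pN(1)[OF w(1)] Nx by metis
      moreover have "w \<noteq> a" using W2[OF w(1)] conjunct1[OF *] by auto
      ultimately have "h \<in> N b" using hW(1)[OF w(1)] by simp
      then have "h \<in> {a, x}" using Nb by metis
      then have "h = a" using x2 h(2) by auto
      then show ?thesis using ab False by (auto simp: W_def)
    qed auto
    then show "\<not> (c' {a, x} = 0 \<and> c' {a, b} = 1 \<and> c' {x, b} = 1)"
    proof
      assume xS: "x \<in> S"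
      then have "N x \<subseteq> S" using closed2 x2 by auto
      then have "c' {a, x} = c {a, x}" "c' {a, b} = c {a, b}" "c' {x, b} = c {x, b}"
        unfolding Nx using xS by (auto intro!: c'S)
      then show ?thesis using tr * xS unfolding reserved_triangle_def by metis
    next
      assume xW: "x \<in> W"
      have "h \<noteq> b" using x2 h(2) by auto
      moreover have "{h, p x} = {a, b}" using p(1)[OF xW] Nx by metis
      ultimately have ah: "a = h" "b = p x" by (simp_all add: doubleton_eq_iff)
      then have xT: "x \<in> T" using xW ab by (auto simp: T_def)
      have bT: "b \<in> T" "p b = x" unfolding ah(2) using pT[OF xT] .
      then have bW: "b \<in> W" using TW by blast
      show ?thesis
      proof
        assume **: "c' {a, x} = 0 \<and> c' {a, b} = 1 \<and> c' {x, b} = 1"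
        have "L1 x = 0" using ** c'h(1)[OF xW] ah(1) by simp
        then have x1: "x \<in> T1" using L0[OF xT] by simp
        then have b1: "b \<notin> T1" using T1p[OF xT] unfolding ah(2) by simp
        have "L1 b = 1" using ** c'h(1)[OF bW] ah(1) by simp
        then have "fst (q x) = 1" using b1 bT by (simp add: L1_def)
        moreover have "L2 x = 1" using ** c'p(1)[OF xW] unfolding ah(2)[symmetric] by simp
        then have "snd (q x) = 1" using x1 by (simp add: L2_def)
        ultimately have "q x = (1, 1)" by (simp add: prod_eq_iff)
        then show False using qT1(4)[OF x1] by simp
      qed
    qed
  qed
  moreover have "\<forall>e. e \<subseteq> S0 \<longrightarrow> c' e = c0 e" using c0 c'S S0 by auto
  ultimately have "grown r S0 c0 S' c'" using S0 c'k unfolding grown_def by (auto simp: S'_def)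
  moreover have "S \<subset> S'" using h(3) by (auto simp: S'_def W_def)
  ultimately show ?thesis by blast
qed

text \<open>Take a maximal grown set. If it were proper, an edge leaving it would start at a vertex
  where one of the two growth steps applies; the step at a large vertex is used only when no vertex
  of degree 2 can be extended.\<close>

lemma extend_core:
  assumes core: "closed_core S0" "S0 \<noteq> {}" and r: "r < k" and c0: "\<And>e. e \<in> E \<Longrightarrow> c0 e < k"
  obtains c where "grown r S0 c0 V c"
proof -
  let ?P = "\<lambda>S. \<exists>c. grown r S0 c0 S c"
  have "grown r S0 c0 S0 c0"
  proof -
    have "reserved_path2 r S0 S0 c0" "reserved_triangle S0 S0 c0"
      by (simp_all add: reserved_path2_def reserved_triangle_def)
    moreover have "reserved_path3 r S0 S0 c0" unfolding reserved_path3_def by blast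
    moreover have "rigid S0 S0 c0" by (simp add: rigid_def)
    ultimately show ?thesis using core(1) c0 by (simp add: grown_def)
  qed
  then have "?P S0" by blast
  moreover have fin: "finite {S. ?P S}"
    by (rule finite_subset[of _ "Pow V"]) (use finite_V in \<open>auto simp: grown_def closed_core_def\<close>)
  ultimately obtain S where S: "?P S" "\<And>S'. ?P S' \<Longrightarrow> S \<subseteq> S' \<Longrightarrow> S = S'"
    using finite_has_maximal[of "{S. ?P S}"] by blast
  then obtain c where c: "grown r S0 c0 S c" by blast
  then have SV: "S0 \<subseteq> S" "S \<subseteq> V" by (auto simp: grown_def closed_core_def)
  have "S = V"
  proof (rule ccontr)
    assume "S \<noteq> V"
    then obtain v w where vw: "v \<in> S" "w \<in> N v" "w \<notin> S" using boundary_edge[of S] SV core(2) by auto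
    have "\<exists>S' c'. S \<subset> S' \<and> grown r S0 c0 S' c'"
    proof (cases "\<exists>v\<in>S. card (N v) = 2 \<and> \<not> N v \<subseteq> S")
      case True
      then show ?thesis using grow_at_degree_2[OF c] by blast
    next
      case False
      then have "3 \<le> card (N v)" using N_big_cases[of v] vw SV by blast
      then show ?thesis using grow_at_big[OF c r _ vw(1)] False vw by blast
    qed
    then show False using S(2) by blast
  qed
  then show ?thesis using that c by blast
qed

section \<open>Cores\<close>

definition distinguishable :: bool where
  "distinguishable \<longleftrightarrow> (\<exists>c. (\<forall>e\<in>E. c e < k) \<and> distinguishing_edge_labeling V E c)"

text \<open>Rigidity of the final labeling over \<open>S0\<close> reduces the task to fixing
  \<open>S0\<close> itself. For this one knows the labels inside the core and that the reserved
  patterns do not occur elsewhere.\<close>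

lemma distinguishable_from_core:
  assumes core: "closed_core S0" "S0 \<noteq> {}" and r: "r < k" and c0: "\<And>e. e \<in> E \<Longrightarrow> c0 e < k"
    and fixed: "\<And>c f v. (\<And>e. e \<subseteq> S0 \<Longrightarrow> c e = c0 e) \<Longrightarrow> reserved_path2 r S0 V c \<Longrightarrow>
      reserved_path3 r S0 V c \<Longrightarrow> reserved_triangle S0 V c \<Longrightarrow> label_auto V E c f \<Longrightarrow> v \<in> S0 \<Longrightarrow> f v = v"
  shows distinguishable
proof -
  obtain c where "grown r S0 c0 V c" by (rule extend_core[OF core r c0])
  then have g: "\<forall>e. e \<subseteq> S0 \<longrightarrow> c e = c0 e" "\<forall>e\<in>E. c e < k" "rigid S0 V c"
      "reserved_path2 r S0 V c" "reserved_path3 r S0 V c" "reserved_triangle S0 V c"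
    by (simp_all add: grown_def)
  have "f v = v" if f: "label_auto V E c f" and v: "v \<in> V" for f v
  proof -
    have "\<forall>u\<in>S0. f u = u"
      by (intro ballI fixed[OF g(1)[rule_format] g(4-6) f])
    then show ?thesis using g(3)[unfolded rigid_def, rule_format, of c f v] f v by simp
  qed
  then have "distinguishing_edge_labeling V E c"
    by (simp add: distinguishing_edge_labeling_def label_auto_def)
  then show ?thesis unfolding distinguishable_def using g(2) by (intro exI conjI)
qed

lemma reserved_path2D:
  assumes "reserved_path2 r S0 S c" "w \<in> S" "w \<notin> S0" "N w = {h, z}" "3 \<le> card (N h)" "3 \<le> card (N z)"
  shows "(c {h, w}, c {w, z}) \<noteq> (r, 0) \<or> (c {z, w}, c {w, h}) \<noteq> (r, 0)"
  by (rule assms(1)[unfolded reserved_path2_def, rule_format]) (intro conjI assms)+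

lemma reserved_path3D:
  assumes "reserved_path3 r S0 S c" "3 \<le> card (N h)" "N w = {h, z}" "card (N z) = 2" "z \<notin> N h"
    "h \<in> S" "w \<in> S" "\<not> {h, w} \<subseteq> S0"
  shows "c {h, w} = 0 \<or> z \<in> S \<and> (c {h, w}, c {w, z}) \<noteq> (r, 0)"
  by (rule assms(1)[unfolded reserved_path3_def, rule_format])
    (intro conjI insert_subsetI empty_subsetI assms)

section \<open>Cores containing two adjacent vertices of degree 2\<close>

text \<open>The core path carries the labels 1, 0, and \<open>(1, 0)\<close> is reserved. Its image
  has the same labels and degrees, so the image of its first edge must lie in the core, where
  degrees and the non-adjacency of \<open>z\<close> and \<open>v\<close> leave only the
  identity.\<close>

lemma core_path3:
  assumes v: "3 \<le> card (N v)" and w: "N w = {v, z}" and z: "card (N z) = 2" "z \<notin> N v"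
  shows distinguishable
proof -
  have wv: "w \<in> N v" "v \<in> N w" and wz: "z \<in> N w" "w \<in> N z" using w N_sym by auto
  have w2: "card (N w) = 2" using N_of_big[OF v] wv by auto
  have ne: "v \<noteq> w" "v \<noteq> z" "w \<noteq> z" using v z w2 N_irrefl wz by auto
  have VV: "v \<in> V" "w \<in> V" "z \<in> V" using wv wz N_V by auto
  obtain y where y: "N z = {w, y}" "y \<noteq> w" using N_other[OF z(1) wz(2)] by metis
  have "y \<in> N z" using y by simp
  then have "y \<noteq> v" "y \<noteq> z" using z(2) N_sym N_irrefl by blast+
  then have y': "y \<notin> N w" using w by simp
  let ?S = "{v, w, z}" and ?c = "\<lambda>e. if e = {v, w} then 1 else 0 :: nat"
  show ?thesis
  proof (rule distinguishable_from_core[of ?S 1 ?c])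
    have "\<exists>a b. N z = {a, b} \<and> card (N a) = 2 \<and> b \<notin> N a" using y y' w2 by blast
    moreover have "\<exists>u\<in>N x. u \<in> ?S" if "x \<in> ?S" for x
      using that wv wz by auto
    ultimately show "closed_core ?S" unfolding closed_core_def using VV v w by auto
  next
    fix c f x
    assume c: "\<And>e. e \<subseteq> ?S \<Longrightarrow> c e = ?c e" and p3: "reserved_path3 1 ?S V c"
      and f: "label_auto V E c f" and x: "x \<in> ?S"
    have Nf: "N (f w) = {f v, f z}" using auto_N[OF f] VV w by simp
    have zv: "f z \<notin> N (f v)" using auto_edge[OF f] VV z by simp
    have deg: "3 \<le> card (N (f v))" "card (N (f z)) = 2" "card (N (f w)) = 2"
      using auto_card[OF f] VV v z w2 by simp_all
    have cf: "c {f v, f w} = 1" "c {f w, f z} = 0"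
      using auto_label[OF f wv(1)] auto_label[OF f wz(1)] c ne by (simp_all add: doubleton_eq_iff)
    have inS: "{f v, f w} \<subseteq> ?S"
    proof (rule ccontr)
      assume "\<not> {f v, f w} \<subseteq> ?S"
      then show False
        using reserved_path3D[OF p3 deg(1) Nf deg(2) zv auto_V[OF f VV(1)] auto_V[OF f VV(2)]] cf by simp
    qed
    then have fv: "f v = v" using w2 z deg by auto
    have "f w \<in> N (f v)" using auto_edge[OF f] VV wv by simp
    then have fw: "f w = w" using inS fv z N_irrefl[of v] by auto
    then have "{v, z} = {v, f z}" using Nf w fv by simp
    then show "f x = x" using x fv fw by (auto simp: doubleton_eq_iff)
  qed (use k_ge in auto)
qed

text \<open>The core carries the reserved pattern 0, 1, 1, so it is mapped to itself; the different
  labels of \<open>{v, w}\<close> and \<open>{v, z}\<close> prevent a swap of \<open>w\<close> and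
  \<open>z\<close>.\<close>

lemma core_triangle:
  assumes v: "3 \<le> card (N v)" and w: "N w = {v, z}" and z: "N z = {v, w}"
  shows distinguishable
proof -
  have wv: "w \<in> N v" "v \<in> N w" and wz: "z \<in> N w" "w \<in> N z" and zv: "z \<in> N v" "v \<in> N z"
    using w z N_sym by auto
  have w2: "card (N w) = 2" "card (N z) = 2" using N_of_big[OF v] wv zv by auto
  have ne: "v \<noteq> w" "v \<noteq> z" "w \<noteq> z" using v w2 N_irrefl wz by auto
  have VV: "v \<in> V" "w \<in> V" "z \<in> V" using wv wz N_V by auto
  let ?S = "{v, w, z}" and ?c = "\<lambda>e. if e = {v, w} then 0 else 1 :: nat"
  show ?thesis
  proof (rule distinguishable_from_core[of ?S 1 ?c])
    have "\<exists>u\<in>N x. u \<in> ?S" if "x \<in> ?S" for x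
      using that wv wz by auto
    then show "closed_core ?S" unfolding closed_core_def using VV v w z by auto
  next
    fix c f x
    assume c: "\<And>e. e \<subseteq> ?S \<Longrightarrow> c e = ?c e" and tr: "reserved_triangle ?S V c"
      and f: "label_auto V E c f" and x: "x \<in> ?S"
    have Nf: "N (f w) = {f v, f z}" "N (f z) = {f v, f w}" using auto_N[OF f] VV w z by simp_all
    have deg: "3 \<le> card (N (f v))" "card (N (f w)) = 2" "card (N (f z)) = 2"
      using auto_card[OF f] VV v w2 by simp_all
    have cf: "c {f v, f w} = c {v, w}" "c {f v, f z} = c {v, z}" "c {f w, f z} = c {w, z}"
      using auto_label[OF f] wv zv wz by simp_all
    have cc: "c {v, w} = 0" "c {v, z} = 1" "c {w, z} = 1" using c ne by (auto simp: doubleton_eq_iff)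
    have "f w \<in> ?S" using tr Nf deg cf cc auto_V[OF f VV(2)] unfolding reserved_triangle_def by metis
    then have "f w = w \<or> f w = z" using deg v by auto
    moreover have "f w \<noteq> z"
    proof
      assume fw: "f w = z"
      have "{f v, f z} = {v, w}" using Nf(1) z fw by simp
      then have "f v = v" using deg(1) w2 by (auto simp: doubleton_eq_iff)
      then show False using cf(1) cc fw by simp
    qed
    ultimately have fw: "f w = w" by simp
    have "{f v, f z} = {v, z}" using Nf(1) w fw by simp
    then have "f v = v \<and> f z = z" using deg(1) w2 by (auto simp: doubleton_eq_iff)
    then show "f x = x" using x fw by auto
  qed (use k_ge in auto)
qed

section \<open>Cores consisting of two large vertices and their common neighbours\<close>

text \<open>The common neighbours get distinct pairs of labels. The pair \<open>(0, 0)\<close> at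
  \<open>w0\<close> is reserved and makes the core recognisable; \<open>(0, 1)\<close> is used at
  \<open>w1\<close> while \<open>(1, 0)\<close> is left out, so \<open>x\<close> and
  \<open>y\<close> cannot be swapped. The strict bound by \<open>k\<^sup>2\<close> is what allows a
  pair to be left out.\<close>

lemma core_parallel:
  assumes xy: "x \<noteq> y" "3 \<le> card (N x)" "3 \<le> card (N y)"
    and C: "2 \<le> card (N x \<inter> N y)" "card (N x \<inter> N y) < k\<^sup>2"
  shows distinguishable
proof -
  define C where "C = N x \<inter> N y"
  have finC: "finite C" using finite_N by (simp add: C_def)
  have w2: "card (N w) = 2" and CN: "w \<in> N x" "w \<in> N y" "x \<in> N w" "y \<in> N w" if "w \<in> C" for w
    using that N_of_big[OF xy(2)] N_sym[of w x] N_sym[of w y] by (auto simp: C_def)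
  have NC: "N w = {x, y}" if w: "w \<in> C" for w
  proof -
    obtain z where "N w = {x, z}" using N_other[OF w2[OF w] CN(3)[OF w]] by metis
    then show ?thesis using CN(4)[OF w] xy(1) by auto
  qed
  have NCI: "w \<in> C" if "N w = {x, y}" for w using that N_sym[of x w] N_sym[of y w] by (auto simp: C_def)
  obtain w0 w1 where w01: "w0 \<in> C" "w1 \<in> C" "w0 \<noteq> w1"
    using C(1) finC unfolding C_def[symmetric] by (metis card_le_Suc0_iff_eq not_less_eq_eq numeral_2_eq_2)
  have xyC: "x \<notin> C" "y \<notin> C" using w2 xy by fastforce+
  have VV: "x \<in> V" "y \<in> V" "C \<subseteq> V" using CN[OF w01(1)] N_V by (auto simp: C_def)
  obtain g where g: "inj_on g (C - {w0, w1})"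
    "g ` (C - {w0, w1}) \<subseteq> {..<k} \<times> {..<k} - {(0, 0), (0, 1), (1, 0::nat)}"
  proof (rule inj_into_finite)
    have "{(0, 0), (0, 1), (1, 0::nat)} \<subseteq> {..<k} \<times> {..<k}" using k_ge by auto
    then have "card ({..<k} \<times> {..<k} - {(0, 0), (0, 1), (1, 0::nat)}) = k\<^sup>2 - 3"
      by (subst card_Diff_subset) (auto simp: power2_eq_square)
    moreover have "card (C - {w0, w1}) = card C - 2"
      using w01 by (subst card_Diff_subset) auto
    ultimately show "card (C - {w0, w1}) \<le> card ({..<k} \<times> {..<k} - {(0, 0), (0, 1), (1, 0::nat)})"
      using C unfolding C_def[symmetric] by simp
  qed (use finC in auto)
  define F where "F = g(w0 := (0, 0), w1 := (0, 1))"
  have gC: "g w \<in> {..<k} \<times> {..<k} - {(0, 0), (0, 1), (1, 0::nat)}" if "w \<in> C" "w \<noteq> w0" "w \<noteq> w1" for w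
    using g(2) that by blast
  have F0: "F w0 = (0, 0)" "F w1 = (0, 1)" using w01 by (auto simp: F_def)
  have Fk: "F w \<in> {..<k} \<times> {..<k}" and F10: "F w \<noteq> (1, 0)" if "w \<in> C" for w
    using gC[OF that] k_ge by (auto simp: F_def)
  have Finj: "w = w'" if "F w = F w'" "w \<in> C" "w' \<in> C" for w w'
    using that(1) gC[OF that(2)] gC[OF that(3)] inj_onD[OF g(1), of w w'] that(2,3)
    by (auto simp: F_def split: if_splits)
  let ?S = "{x, y} \<union> C"
  \<comment> \<open>The reduction modulo \<open>k\<close> only bounds the meaningless values off the
    core; inside it the components of \<open>F\<close> are already below \<open>k\<close>.\<close>
  let ?c = "\<lambda>e. (if x \<in> e then fst (F (the_elem (e - {x}))) else snd (F (the_elem (e - {y})))) mod k"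
  show ?thesis
  proof (rule distinguishable_from_core[of ?S 0 ?c])
    have "\<exists>u\<in>N v. u \<in> ?S" if "v \<in> ?S" for v
      using that CN[OF w01(1)] w01(1) CN by blast
    moreover have "N v \<subseteq> ?S" if "v \<in> ?S" "card (N v) = 2" for v using that NC xy by auto
    ultimately show "closed_core ?S" unfolding closed_core_def using VV by auto
  next
    fix c f v
    assume c: "\<And>e. e \<subseteq> ?S \<Longrightarrow> c e = ?c e" and p2: "reserved_path2 0 ?S V c"
      and f: "label_auto V E c f" and v: "v \<in> ?S"
    have cx: "c {x, w} = fst (F w)" and cy: "c {y, w} = snd (F w)" if w: "w \<in> C" for w
    proof -
      have 1: "{x, w} - {x} = {w}" "{y, w} - {y} = {w}" "x \<notin> {y, w}" using w xyC xy by auto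
      have "fst (F w) < k" "snd (F w) < k" using Fk[OF w] by auto
      then show "c {x, w} = fst (F w)" "c {y, w} = snd (F w)" using c[of "{x, w}"] c[of "{y, w}"] 1 w by auto
    qed
    have lab: "c {f x, f w} = fst (F w)" "c {f y, f w} = snd (F w)" if w: "w \<in> C" for w
      using auto_label[OF f CN(1)[OF w]] auto_label[OF f CN(2)[OF w]] cx[OF w] cy[OF w] by simp_all
    have Nf: "N (f w) = {f x, f y}" if w: "w \<in> C" for w using auto_N[OF f] VV w NC by auto
    have deg: "3 \<le> card (N (f x))" "3 \<le> card (N (f y))" "card (N (f w0)) = 2"
      using auto_card[OF f] VV xy w2[OF w01(1)] w01 by auto
    have "c {f x, f w0} = 0" "c {f y, f w0} = 0" using lab[OF w01(1)] F0 by auto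
    \<comment> \<open>The pair \<open>(0, 0)\<close> reads the same in both directions, so
      \<open>reserved_path2\<close> excludes it outside the core.\<close>
    then have "f w0 \<in> ?S"
      using reserved_path2D[OF p2 _ _ Nf[OF w01(1)] deg(1,2)] auto_V[OF f] VV(3) w01(1)
      by (metis insert_commute subsetD)
    then have "f w0 \<in> C" using deg xy by auto
    then have fxy: "{f x, f y} = {x, y}" using Nf[OF w01(1)] NC by metis
    have fC: "f w \<in> C" if "w \<in> C" for w using NCI Nf[OF that] fxy by metis
    have "f x = x \<and> f y = y"
    proof (rule ccontr)
      assume "\<not> (f x = x \<and> f y = y)"
      then have "f x = y" "f y = x" using fxy by (auto simp: doubleton_eq_iff)
      \<comment> \<open>A swap of \<open>x\<close> and \<open>y\<close> reverses the pair
        \<open>(0, 1)\<close> of \<open>w1\<close>.\<close>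
      then have "F (f w1) = (1, 0)"
        using lab[OF w01(2)] cx[OF fC[OF w01(2)]] cy[OF fC[OF w01(2)]] F0 by (simp add: prod_eq_iff)
      then show False using F10 fC w01 by auto
    qed
    moreover have "f w = w" if w: "w \<in> C" for w
      using lab[OF w] cx[OF fC[OF w]] cy[OF fC[OF w]] Finj[OF _ fC[OF w] w] calculation
      by (simp add: prod_eq_iff)
    ultimately show "f v = v" using v by auto
  qed (use k_ge in auto)
qed

section \<open>Cycle cores\<close>

definition cyclic_path :: "(nat \<Rightarrow> 'a) \<Rightarrow> nat \<Rightarrow> bool" where
  "cyclic_path u n \<longleftrightarrow> 3 \<le> n \<and> inj_on u {..<n} \<and> (\<forall>i. Suc i < n \<longrightarrow> u (Suc i) \<in> N (u i)) \<and> u 0 \<in> N (u (n - 1))"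

text \<open>Degrees alternate along the cycle, so \<open>n\<close> is even. With
  \<open>(0, 0)\<close> reserved, every vertex of degree 2 whose two edges have label 0 lies on the
  cycle. These vertices recover the path \<open>u 0, ..., u (n - 2)\<close>, and the single label 1
  orients it.\<close>

lemma core_cycle:
  assumes subdiv: "\<And>u w. w \<in> N u \<Longrightarrow> card (N u) = 2 \<Longrightarrow> 3 \<le> card (N w)"
    and uniq: "\<And>x y w w'. x \<noteq> y \<Longrightarrow> 3 \<le> card (N x) \<Longrightarrow> 3 \<le> card (N y) \<Longrightarrow>
      w \<in> N x \<Longrightarrow> w \<in> N y \<Longrightarrow> w' \<in> N x \<Longrightarrow> w' \<in> N y \<Longrightarrow> w = w'"
    and u: "cyclic_path u n" "3 \<le> card (N (u 0))"
  shows distinguishable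
proof -
  have n3: "3 \<le> n" and inj: "inj_on u {..<n}" and adj: "\<And>i. Suc i < n \<Longrightarrow> u (Suc i) \<in> N (u i)"
    and adj0: "u 0 \<in> N (u (n - 1))"
    using u(1) by (auto simp: cyclic_path_def)
  have u_eq: "u i = u j \<longleftrightarrow> i = j" if "i < n" "j < n" for i j
    using inj that by (auto simp: inj_on_def)
  have adj': "u i \<in> N (u (Suc i))" if "Suc i < n" for i using N_sym[OF adj[OF that]] .
  have adj0': "u (n - 1) \<in> N (u 0)" using N_sym[OF adj0] .
  have uV: "u i \<in> V" if "i < n" for i
  proof (cases "Suc i < n")
    case True then show ?thesis using adj' N_V by blast
  next
    case False
    then have "i = n - 1" using that by simp
    then show ?thesis using adj0' N_V by blast
  qed
  have parity: "if even i then 3 \<le> card (N (u i)) else card (N (u i)) = 2" if "i < n" for i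
    using that
  proof (induction i)
    case 0 then show ?case using u(2) by simp
  next
    case (Suc i)
    then have "u (Suc i) \<in> N (u i)" using adj by simp
    then show ?case using Suc subdiv[of "u (Suc i)" "u i"] N_of_big[of "u i" "u (Suc i)"] by (cases "even i") auto
  qed
  have par: "even i \<longleftrightarrow> 3 \<le> card (N (u i))" "odd i \<longleftrightarrow> card (N (u i)) = 2" if "i < n" for i
    using parity[OF that] by (auto split: if_splits)
  have "card (N (u (n - 1))) = 2" using N_of_big[OF u(2) adj0'] .
  then have n: "odd (n - 1)" "even n" using par[of "n - 1"] n3 by auto
  then have n4: "4 \<le> n" using n3 by presburger
  have Nodd: "N (u i) = {u (i - 1), u (Suc i)}" if i: "odd i" "Suc i < n" for i
  proof -
    obtain j where j: "i = Suc j" using i by (cases i) auto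
    have "card (N (u i)) = 2" using par i by simp
    moreover have "u j \<in> N (u i)" using adj' i j by simp
    ultimately obtain z where z: "N (u i) = {u j, z}" "z \<noteq> u j" using N_other by metis
    moreover have "u (Suc i) \<in> N (u i)" using adj i by simp
    moreover have "u (Suc i) \<noteq> u j" using u_eq[of "Suc i" j] i j by simp
    ultimately show ?thesis using j by auto
  qed
  have Nlast: "N (u (n - 1)) = {u (n - 2), u 0}"
  proof -
    have "u (n - 2) \<in> N (u (n - 1))" using adj'[of "n - 2"] n3 by (simp add: Suc_diff_Suc numeral_2_eq_2)
    then obtain z where z: "N (u (n - 1)) = {u (n - 2), z}" "z \<noteq> u (n - 2)"
      using N_other \<open>card (N (u (n - 1))) = 2\<close> by metis
    moreover have "u 0 \<noteq> u (n - 2)" using u_eq[of 0 "n - 2"] n3 by simp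
    ultimately show ?thesis using adj0 by auto
  qed
  let ?S = "u ` {..<n}" and ?c = "\<lambda>e. if e = {u (n - 1), u 0} then 1 else 0 :: nat"
  show ?thesis
  proof (rule distinguishable_from_core[of ?S 0 ?c])
    have "\<exists>x\<in>N v. x \<in> ?S" if v: "v \<in> ?S" for v
    proof -
      obtain i where i: "i < n" "v = u i" using v by auto
      show ?thesis
      proof (cases "Suc i < n")
        case True then show ?thesis using adj i by auto
      next
        case False
        then have "i = n - 1" using i by simp
        then have "v = u (n - 1)" using i by simp
        then show ?thesis using adj0 n3 by (intro bexI[of _ "u 0"]) auto
      qed
    qed
    moreover have "N v \<subseteq> ?S" if v: "v \<in> ?S" "card (N v) = 2" for v
    proof -
      obtain i where i: "i < n" "v = u i" using v by auto
      then have "odd i" using par v by simp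
      then show ?thesis
      proof (cases "Suc i < n")
        case True then show ?thesis using Nodd[of i] \<open>odd i\<close> i by auto
      next
        case False
        then have "i = n - 1" using i by simp
        then have "v = u (n - 1)" using i by simp
        then show ?thesis using Nlast n3 by auto
      qed
    qed
    ultimately show "closed_core ?S" unfolding closed_core_def using uV by auto
  next
    fix c f v
    assume c: "\<And>e. e \<subseteq> ?S \<Longrightarrow> c e = ?c e" and p2: "reserved_path2 0 ?S V c"
      and f: "label_auto V E c f" and v: "v \<in> ?S"
    \<comment> \<open>Membership in \<open>Z\<close> depends only on degrees and labels, so
      \<open>f\<close> preserves it.\<close>
    define Z where "Z = {w \<in> V. card (N w) = 2 \<and> (\<forall>y\<in>N w. c {w, y} = 0)}"
    have fZ: "f w \<in> Z \<longleftrightarrow> w \<in> Z" if w: "w \<in> V" for w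
    proof -
      have "(\<forall>y\<in>N (f w). c {f w, y} = 0) \<longleftrightarrow> (\<forall>y\<in>N w. c {w, y} = 0)"
        unfolding auto_N[OF f w] using auto_label[OF f] by auto
      then show ?thesis using w auto_V[OF f w] auto_card[OF f w] by (simp add: Z_def)
    qed
    have clast: "c {u (n - 1), u 0} = 1" using c n3 by simp
    have Z1: "\<exists>i. odd i \<and> Suc i < n \<and> w = u i" if w: "w \<in> Z" for w
    proof -
      have "w \<in> V" "card (N w) = 2" using w by (auto simp: Z_def)
      then obtain a b where ab: "N w = {a, b}" by (auto simp: card_2_iff)
      then have "a \<in> N w" "b \<in> N w" by auto
      then have "3 \<le> card (N a)" "3 \<le> card (N b)" and l: "c {a, w} = 0" "c {w, a} = 0" "c {w, b} = 0" "c {b, w} = 0"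
        using subdiv \<open>card (N w) = 2\<close> w by (auto simp: Z_def insert_commute)
      then have "w \<in> ?S" using reserved_path2D[OF p2 \<open>w \<in> V\<close> _ ab] by auto
      then obtain i where i: "i < n" "w = u i" by auto
      then have "odd i" using par \<open>card (N w) = 2\<close> by simp
      moreover have "i \<noteq> n - 1" using clast w Nlast i by (auto simp: Z_def)
      ultimately show ?thesis using i by (intro exI[of _ i]) auto
    qed
    have Z2: "u i \<in> Z" if i: "odd i" "Suc i < n" for i
    proof -
      have "c {u i, y} = 0" if y: "y \<in> N (u i)" for y
      proof -
        have "{u i, y} \<noteq> {u (n - 1), u 0}"
        proof
          assume "{u i, y} = {u (n - 1), u 0}"
          then have "u i = u (n - 1) \<or> u i = u 0" by (auto simp: doubleton_eq_iff)
          then show False using u_eq[of i "n - 1"] u_eq[of i 0] i by auto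
        qed
        moreover have "{u i, y} \<subseteq> ?S" using y Nodd[OF i] i by auto
        ultimately show ?thesis using c by simp
      qed
      then show ?thesis using par i uV by (simp add: Z_def)
    qed
    \<comment> \<open>\<open>Z\<close> consists of the odd vertices of the cycle but the last, so \<open>P\<close> singles out the ends of the path
      \<open>u 0, \<dots>, u (n - 2)\<close>; their common neighbour \<open>u (n - 1)\<close> tells them apart.\<close>
    define P where "P = (\<lambda>v. v \<in> V \<and> 3 \<le> card (N v) \<and> (\<exists>!a. a \<in> Z \<and> a \<in> N v))"
    have fP: "P (f v)" if v: "P v" for v
    proof -
      have vV: "v \<in> V" using v by (simp add: P_def)
      obtain a where a: "a \<in> Z" "a \<in> N v" "\<And>b. b \<in> Z \<Longrightarrow> b \<in> N v \<Longrightarrow> b = a"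
        using v by (auto simp: P_def)
      have "b = f a" if b: "b \<in> Z" "b \<in> N (f v)" for b
      proof -
        obtain b' where b': "b' \<in> N v" "b = f b'" using b(2) unfolding auto_N[OF f vV] by blast
        then have "b' \<in> Z" using fZ[OF N_V[OF b'(1)]] b(1) by simp
        then show ?thesis using a(3) b' by simp
      qed
      moreover have "f a \<in> Z" "f a \<in> N (f v)"
        using a(1,2) fZ[OF N_V[OF a(2)]] auto_N[OF f vV] by simp_all
      ultimately have "\<exists>!a. a \<in> Z \<and> a \<in> N (f v)" by blast
      then show ?thesis using v auto_V[OF f] auto_card[OF f] by (simp add: P_def)
    qed
    have P_ends: "v = u 0 \<or> v = u (n - 2)" if v: "P v" for v
    proof -
      obtain a where a: "a \<in> Z" "a \<in> N v" using v by (auto simp: P_def)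
      then obtain i where i: "odd i" "Suc i < n" "a = u i" using Z1 by blast
      have "v \<in> {u (i - 1), u (Suc i)}" using N_sym[OF a(2)] Nodd i by simp
      then consider "v = u (i - 1)" | "v = u (Suc i)" by auto
      then have "\<exists>j. even j \<and> Suc j < n \<and> v = u j"
      proof cases
        case 1
        have "even (i - 1)" "Suc (i - 1) < n" using i by simp_all
        then show ?thesis using 1 by blast
      next
        case 2
        have "even (Suc i)" using i(1) by simp
        moreover have "Suc i \<noteq> n - 1" using n(1) i(1) by (metis even_Suc)
        then have "Suc (Suc i) < n" using i(2) by simp
        ultimately show ?thesis using 2 by blast
      qed
      then obtain j where j: "even j" "Suc j < n" "v = u j" by blast
      show ?thesis
      proof (rule ccontr)
        assume *: "\<not> ?thesis"
        have "j \<noteq> 0" using * j by metis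
        moreover have "j \<noteq> n - 2" using * j by metis
        moreover have "Suc j \<noteq> n - 1" using calculation by auto
        ultimately have l: "j = Suc (j - 1)" "odd (j - 1)" "Suc (Suc j) < n"
          using j by simp_all
        define l where "l = j - 1"
        note l = l[folded l_def]
        have "u l \<in> Z" "u (Suc j) \<in> Z" using Z2 l j by auto
        moreover have "u l \<in> N v" "u (Suc j) \<in> N v" using adj[of j] adj'[of l] l j by auto
        ultimately have "u l = u (Suc j)" using v by (auto simp: P_def)
        then show False using u_eq[of l "Suc j"] l by simp
      qed
    qed
    have P0: "P (u 0)"
    proof -
      have "a = u 1" if a: "a \<in> Z" "a \<in> N (u 0)" for a
      proof -
        obtain i where i: "odd i" "Suc i < n" "a = u i" using Z1 a by blast
        then have "u 0 \<in> {u (i - 1), u (Suc i)}" using N_sym[OF a(2)] Nodd by simp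
        then have "i = 1" using i u_eq[of 0 "i - 1"] u_eq[of 0 "Suc i"] by (cases i) auto
        then show ?thesis using i by simp
      qed
      moreover have "u 1 \<in> Z" "u 1 \<in> N (u 0)" using Z2[of 1] adj[of 0] n4 by auto
      ultimately show ?thesis using u(2) uV n3 by (auto simp: P_def)
    qed
    have last_N: "u (n - 1) \<in> N (u 0)" "u (n - 1) \<in> N (u (n - 2))"
      using adj0' Nlast N_sym[of "u (n - 2)" "u (n - 1)"] by auto
    have P2: "P (u (n - 2))"
    proof -
      have "a = u (n - 3)" if a: "a \<in> Z" "a \<in> N (u (n - 2))" for a
      proof -
        obtain i where i: "odd i" "Suc i < n" "a = u i" using Z1 a by blast
        then have "u (n - 2) \<in> {u (i - 1), u (Suc i)}" using N_sym[OF a(2)] Nodd by simp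
        then have "n - 2 = i - 1 \<or> n - 2 = Suc i"
          using i u_eq[of "n - 2" "i - 1"] u_eq[of "n - 2" "Suc i"] by auto
        then have "i = n - 3" using i n4 by auto
        then show ?thesis using i by simp
      qed
      moreover have "Suc (n - 3) = n - 2" "odd (n - 3)" using n n4 by auto
      then have "u (n - 3) \<in> Z" "u (n - 3) \<in> N (u (n - 2))" using Z2[of "n - 3"] adj'[of "n - 3"] n4 by auto
      moreover have "3 \<le> card (N (u (n - 2)))" using par[of "n - 2"] n n4 by auto
      ultimately show ?thesis using uV[of "n - 2"] n3 by (auto simp: P_def)
    qed
    have ends: "f (u 0) = u 0 \<or> f (u 0) = u (n - 2)" "f (u (n - 2)) = u 0 \<or> f (u (n - 2)) = u (n - 2)"
      using P_ends fP P0 P2 by blast+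
    have ne: "u 0 \<noteq> u (n - 2)" using u_eq[of 0 "n - 2"] n4 by simp
    have fne: "f (u 0) \<noteq> f (u (n - 2))" using auto_inj[OF f, of "u 0" "u (n - 2)"] uV n3 ne by auto
    have "f (u (n - 1)) \<in> N (f (u 0))" "f (u (n - 1)) \<in> N (f (u (n - 2)))"
      using auto_edge[OF f] last_N uV n3 by auto
    then have "f (u (n - 1)) \<in> N (u 0)" "f (u (n - 1)) \<in> N (u (n - 2))"
      using ends fne by metis+
    \<comment> \<open>The two ends are permuted by \<open>f\<close>, and by \<open>uniq\<close> they
      have only one common neighbour.\<close>
    then have flast: "f (u (n - 1)) = u (n - 1)"
      using uniq[OF ne] last_N P0 P2 unfolding P_def by blast
    \<comment> \<open>Of the two edges at the fixed vertex \<open>u (n - 1)\<close> only the one to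
      \<open>u 0\<close> has label 1.\<close>
    have f0: "f (u 0) = u 0"
    proof (rule ccontr)
      assume "f (u 0) \<noteq> u 0"
      then have *: "f (u 0) = u (n - 2)" using ends by simp
      have "c {u (n - 1), u (n - 2)} = 1"
        using auto_label[OF f adj0] clast flast * by simp
      moreover have "{u (n - 1), u (n - 2)} \<noteq> {u (n - 1), u 0}" using ne by (auto simp: doubleton_eq_iff)
      ultimately show False using c[of "{u (n - 1), u (n - 2)}"] n3 by auto
    qed
    have fu: "f (u i) = u i" if "i < n" for i
      using that
    proof (induction i rule: less_induct)
      case (less i)
      show ?case
      proof (cases "i = 0 \<or> i = n - 1")
        case True then show ?thesis using f0 flast by auto
      next
        case False
        then have i: "0 < i" "Suc i < n" using less.prems by auto
        then obtain j where j: "i = Suc j" by (cases i) auto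
        have fj: "f (u j) = u j" using less j by simp
        have fN: "f (u i) \<in> N (u j)" using auto_edge[OF f, of "u i" "u j"] uV i j adj[of j] fj by auto
        show ?thesis
        proof (cases "odd i")
          case True
          \<comment> \<open>A neighbour of \<open>u (i - 1)\<close> in \<open>Z\<close> is either
            \<open>u i\<close> or an earlier vertex of the cycle; the latter is already fixed and
            hence not the image of \<open>u i\<close>.\<close>
          then have "f (u i) \<in> Z" using fZ uV Z2 i by auto
          then obtain l where l: "odd l" "Suc l < n" "f (u i) = u l" using Z1 by blast
          have "u j \<in> {u (l - 1), u (Suc l)}" using N_sym[OF fN] Nodd l by simp
          then have "j = l - 1 \<or> j = Suc l" using u_eq[of j "l - 1"] u_eq[of j "Suc l"] l i j by auto
          then have "l = i \<or> l < i" using l j by (cases l) auto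
          moreover have "\<not> l < i"
          proof
            assume "l < i"
            then have "f (u l) = f (u i)" using less l by simp
            then have "u l = u i" using auto_inj[OF f] uV l i by simp
            then show False using u_eq[of l i] \<open>l < i\<close> i by simp
          qed
          ultimately show ?thesis using l by simp
        next
          case False
          then have "odd j" using j by simp
          then have "f (u i) \<in> {u (j - 1), u i}" using fN Nodd[of j] j i by simp
          moreover have "f (u i) \<noteq> u (j - 1)"
          proof
            assume *: "f (u i) = u (j - 1)"
            have "f (u (j - 1)) = u (j - 1)" using less j by simp
            then have "u i = u (j - 1)" using * auto_inj[OF f, of "u i" "u (j - 1)"] uV i j by simp
            moreover have "i < n" "j - 1 < n" "i \<noteq> j - 1" using i j by simp_all
            ultimately show False using u_eq by blast
          qed
          ultimately show ?thesis by simp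
        qed
      qed
    qed
    then show "f v = v" using v by auto
  next
    have "0 \<in> {..<n}" using n3 by simp
    then show "?S \<noteq> {}" by blast
  qed (use k_ge in auto)
qed

text \<open>In a longest path all neighbours of the last vertex lie on the path. Having degree at
  least 2, that vertex is adjacent to some \<open>u j\<close> other than its predecessor, which
  closes a cycle.\<close>

lemma cyclic_path_exists:
  assumes subdiv: "\<And>u w. w \<in> N u \<Longrightarrow> card (N u) = 2 \<Longrightarrow> 3 \<le> card (N w)"
  obtains u n where "cyclic_path u n" "3 \<le> card (N (u 0))"
proof -
  define P where "P = (\<lambda>n. \<exists>u. 1 \<le> n \<and> u ` {..<n} \<subseteq> V \<and> inj_on u {..<n} \<and>
    (\<forall>i. Suc i < n \<longrightarrow> u (Suc i) \<in> N (u i)))"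
  have "V \<noteq> {}" using conn by (simp add: connected_graph_def)
  then obtain x where "x \<in> V" by auto
  then have P1: "P 1" unfolding P_def by (intro exI[of _ "\<lambda>_. x"]) (auto simp: inj_on_def)
  have bound: "n \<le> card V" if n: "P n" for n
  proof -
    obtain u where "u ` {..<n} \<subseteq> V" "inj_on u {..<n}" using n by (auto simp: P_def)
    then show ?thesis using card_inj_on_le[of u "{..<n}" V] finite_V by simp
  qed
  define n where "n = (GREATEST n. P n)"
  have "P n" unfolding n_def by (rule GreatestI_nat[where P = P, OF P1]) (rule bound)
  then obtain u where u: "1 \<le> n" "u ` {..<n} \<subseteq> V" "inj_on u {..<n}"
    "\<And>i. Suc i < n \<Longrightarrow> u (Suc i) \<in> N (u i)" unfolding P_def by metis
  have maxi: "m \<le> n" if "P m" for m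
    unfolding n_def by (rule Greatest_le_nat[where P = P, OF that]) (rule bound)
  have end_N: "N (u (n - 1)) \<subseteq> u ` {..<n}"
  proof
    fix x assume x: "x \<in> N (u (n - 1))"
    show "x \<in> u ` {..<n}"
    proof (rule ccontr)
      assume nx: "x \<notin> u ` {..<n}"
      define u' where "u' = u(n := x)"
      have "u' ` {..<Suc n} = insert x (u ` {..<n})" by (auto simp: u'_def lessThan_Suc)
      then have "u' ` {..<Suc n} \<subseteq> V" using u(2) N_V[OF x] by simp
      moreover have "inj_on u' {..<Suc n}"
        using u(3) nx by (auto simp: u'_def lessThan_Suc inj_on_def)
      moreover have "u' (Suc i) \<in> N (u' i)" if i: "Suc i < Suc n" for i
      proof (cases "Suc i = n")
        case True then show ?thesis using x by (auto simp: u'_def)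
      next
        case False then show ?thesis using u(4)[of i] i by (auto simp: u'_def)
      qed
      ultimately have "P (Suc n)" unfolding P_def by (intro exI[of _ u']) auto
      then show False using maxi[of "Suc n"] by simp
    qed
  qed
  have endV: "u (n - 1) \<in> V" using u by auto
  have "\<exists>j. j + 2 < n \<and> u j \<in> N (u (n - 1))"
  proof (rule ccontr)
    assume *: "\<not> ?thesis"
    have "N (u (n - 1)) \<subseteq> {u (n - 2)}"
    proof
      fix x assume x: "x \<in> N (u (n - 1))"
      then obtain j where j: "j < n" "x = u j" using end_N by auto
      then have "j \<noteq> n - 1" using x N_irrefl by auto
      moreover have "\<not> j + 2 < n" using * x j by blast
      ultimately have "j = n - 2" using j by simp
      then show "x \<in> {u (n - 2)}" using j by simp
    qed
    then have "card (N (u (n - 1))) \<le> card {u (n - 2)}" by (intro card_mono) auto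
    then show False using deg_ge[OF endV] by simp
  qed
  then obtain j where j: "j + 2 < n" "u j \<in> N (u (n - 1))" by blast
  have u_eq: "a = b" if "u a = u b" "a < n" "b < n" for a b
    using inj_onD[OF u(3)] that by simp
  show ?thesis
  \<comment> \<open>The cycle has to start at a large vertex: if the last vertex has degree 2, its
    neighbour \<open>u j\<close> is large; otherwise the cycle is traversed backwards from the last
    vertex.\<close>
  proof (cases "card (N (u (n - 1))) = 2")
    case True
    have "inj_on (\<lambda>i. u (j + i)) {..<n - j}"
    proof (rule inj_onI)
      fix x y assume "x \<in> {..<n - j}" "y \<in> {..<n - j}" "u (j + x) = u (j + y)"
      then show "x = y" using u_eq[of "j + x" "j + y"] by simp
    qed
    then have "cyclic_path (\<lambda>i. u (j + i)) (n - j)"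
      unfolding cyclic_path_def using j u(4) by simp
    moreover have "3 \<le> card (N (u (j + 0)))" using subdiv[OF j(2) True] by simp
    ultimately show ?thesis using that by blast
  next
    case False
    have "u (n - 1 - Suc i) \<in> N (u (n - 1 - i))" if "Suc i < n - j" for i
    proof -
      have "Suc (n - 1 - Suc i) = n - 1 - i" "Suc (n - 1 - Suc i) < n" using that by auto
      then show ?thesis using N_sym[OF u(4)[of "n - 1 - Suc i"]] by simp
    qed
    moreover have "n - 1 - (n - j - 1) = j" using j by simp
    moreover have "inj_on (\<lambda>i. u (n - 1 - i)) {..<n - j}"
    proof (rule inj_onI)
      fix x y assume "x \<in> {..<n - j}" "y \<in> {..<n - j}" "u (n - 1 - x) = u (n - 1 - y)"
      then show "x = y" using u_eq[of "n - 1 - x" "n - 1 - y"] by simp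
    qed
    ultimately have "cyclic_path (\<lambda>i. u (n - 1 - i)) (n - j)"
      unfolding cyclic_path_def using j N_sym[OF j(2)] by auto
    moreover have "3 \<le> card (N (u (n - 1 - 0)))" using False N_big_cases[OF endV] by simp
    ultimately show ?thesis using that by blast
  qed
qed

section \<open>The exceptional graphs and the choice of a core\<close>

text \<open>Every vertex of \<open>C\<close> has degree 2 and thus no neighbours besides
  \<open>x\<close> and \<open>y\<close>. So no edge leaves \<open>{x, y} \<union> C\<close>, which
  by connectedness is the whole graph.\<close>

lemma isomorphic_K2:
  assumes xy: "x \<noteq> y" "3 \<le> card (N x)" and C: "N x = N y"
  shows "isomorphic_graphs V E (complete_bipartite_verts 2 (card (N x))) (complete_bipartite_edges 2 (card (N x)))"
proof -
  define C where "C = N x"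
  have NC: "N w = {x, y}" if w: "w \<in> C" for w
  proof -
    have "card (N w) = 2" "x \<in> N w" "y \<in> N w"
      using N_of_big[OF xy(2)] N_sym[of w x] N_sym[of w y] w C by (auto simp: C_def)
    then obtain z where "N w = {x, z}" using N_other by metis
    then show ?thesis using \<open>y \<in> N w\<close> xy(1) by auto
  qed
  have Nxy: "N x = C" "N y = C" using C by (simp_all add: C_def)
  have xyC: "x \<notin> C" "y \<notin> C" using N_irrefl[of x] N_irrefl[of y] Nxy by simp_all
  obtain w where w: "w \<in> C" using xy(2) by (fastforce simp: C_def)
  have "x \<in> N w" "y \<in> N w" using NC[OF w] by simp_all
  then have "x \<in> V" "y \<in> V" using N_V by blast+
  moreover have "C \<subseteq> V" using N_V unfolding C_def by blast
  ultimately have sub: "{x, y} \<union> C \<subseteq> V" by simp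
  have V: "V = {x, y} \<union> C"
  proof (rule ccontr)
    assume "V \<noteq> {x, y} \<union> C"
    then obtain v u where "v \<in> {x, y} \<union> C" "u \<in> N v" "u \<notin> {x, y} \<union> C"
      using boundary_edge[OF sub] by blast
    then show False using NC Nxy by auto
  qed
  have "finite C" using finite_N by (simp add: C_def)
  then obtain g where g: "bij_betw g C {..<card C}"
    using ex_bij_betw_finite_nat[of C] by (auto simp: atLeast0LessThan)
  define f where "f = (\<lambda>v. if v = x then Inl 0 else if v = y then Inl 1 else Inr (g v) :: nat + nat)"
  have f: "f x = Inl 0" "f y = Inl 1" "\<And>w. w \<in> C \<Longrightarrow> f w = Inr (g w)"
    using xy(1) xyC by (auto simp: f_def)
  have fC: "f ` C = Inr ` {..<card C}"
  proof -
    have "f ` C = (\<lambda>w. Inr (g w)) ` C" using f(3) by (rule image_cong[OF refl])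
    also have "\<dots> = Inr ` g ` C" by (simp add: image_image)
    finally show ?thesis using g by (simp add: bij_betw_def)
  qed
  have "bij_betw f V (complete_bipartite_verts 2 (card C))"
    unfolding bij_betw_def
  proof
    show "inj_on f V"
    proof (rule inj_onI)
      fix a b assume ab: "a \<in> V" "b \<in> V" "f a = f b"
      then have "a = x \<or> a = y \<or> a \<in> C" "b = x \<or> b = y \<or> b \<in> C" by (auto simp: V)
      moreover have "a = b" if "a \<in> C" "b \<in> C"
        using inj_onD[OF bij_betw_imp_inj_on[OF g]] ab(3) that f(3) by simp
      ultimately show "a = b" using ab(3) f by (elim disjE) simp_all
    qed
    have "{..<2} = {0, 1::nat}" by auto
    then show "f ` V = complete_bipartite_verts 2 (card C)"
      unfolding V complete_bipartite_verts_def image_Un fC using f(1,2) by simp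
  qed
  moreover have "{u, v} \<in> E \<longleftrightarrow> {f u, f v} \<in> complete_bipartite_edges 2 (card C)" if uv: "u \<in> V" "v \<in> V" for u v
  proof -
    have gk: "w \<in> C \<Longrightarrow> g w < card C" for w using g by (auto simp: bij_betw_def)
    have e: "{u, v} \<in> E \<longleftrightarrow> v \<in> N u" by (simp add: nbrs_def)
    have b: "{p, q} \<in> complete_bipartite_edges 2 (card C) \<longleftrightarrow>
        (\<exists>i<2. \<exists>j<card C. p = Inl i \<and> q = Inr j \<or> p = Inr j \<and> q = Inl i)" for p q
      unfolding complete_bipartite_edges_def by (auto simp: doubleton_eq_iff)
    have Nu: "v \<in> N x \<longleftrightarrow> v \<in> C" "v \<in> N y \<longleftrightarrow> v \<in> C" "u \<in> C \<Longrightarrow> v \<in> N u \<longleftrightarrow> v = x \<or> v = y"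
      using Nxy NC by auto
    have fv: "(\<exists>j<card C. f v = Inr j) \<longleftrightarrow> v \<in> C" "(\<exists>i<2. f v = Inl i) \<longleftrightarrow> v = x \<or> v = y" if "v \<in> V" for v
      using that f gk xyC xy(1) by (auto simp: V less_2_cases_iff)
    have "(\<exists>i<2. \<exists>j<card C. f u = Inl i \<and> f v = Inr j \<or> f u = Inr j \<and> f v = Inl i) \<longleftrightarrow>
        (u = x \<or> u = y) \<and> v \<in> C \<or> u \<in> C \<and> (v = x \<or> v = y)"
      unfolding fv[OF uv(1), symmetric] fv[OF uv(2), symmetric] by blast
    moreover have "v \<in> N u \<longleftrightarrow> (u = x \<or> u = y) \<and> v \<in> C \<or> u \<in> C \<and> (v = x \<or> v = y)"
      using uv(1) Nu xyC unfolding V by blast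
    ultimately show ?thesis unfolding e b by simp
  qed
  ultimately show ?thesis
    unfolding isomorphic_graphs_def graph_iso_def C_def by blast
qed

text \<open>Two large vertices with at least two common neighbours give a parallel core unless they
  share \<open>k\<^sup>2\<close> of them. In that case the degree bound forces equal neighbourhoods,
  which is the excluded graph. Without such vertices a cycle serves as the core.\<close>

lemma distinguishable_subdivided:
  assumes subdiv: "\<And>u w. w \<in> N u \<Longrightarrow> card (N u) = 2 \<Longrightarrow> 3 \<le> card (N w)"
    and K2: "\<not> isomorphic_graphs V E (complete_bipartite_verts 2 (k\<^sup>2)) (complete_bipartite_edges 2 (k\<^sup>2))"
  shows distinguishable
proof (cases "\<exists>x y. x \<noteq> y \<and> 3 \<le> card (N x) \<and> 3 \<le> card (N y) \<and> 2 \<le> card (N x \<inter> N y)")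
  case True
  then obtain x y where xy: "x \<noteq> y" "3 \<le> card (N x)" "3 \<le> card (N y)" "2 \<le> card (N x \<inter> N y)" by blast
  have "card (N x \<inter> N y) < k\<^sup>2"
  proof (rule ccontr)
    assume *: "\<not> card (N x \<inter> N y) < k\<^sup>2"
    have "N x \<inter> N y \<noteq> {}" using xy(4) by auto
    then obtain w where "w \<in> N x" "w \<in> N y" by blast
    then have "x \<in> V" "y \<in> V" using N_V' by blast+
    then have le: "card (N x) \<le> card (N x \<inter> N y)" "card (N y) \<le> card (N x \<inter> N y)" "card (N x) \<le> k\<^sup>2"
      using deg_le[of x] deg_le[of y] * by auto
    have "N x \<inter> N y = N x" "N x \<inter> N y = N y"
      by (rule card_seteq[OF finite_N]; use le in simp)+
    then have "N x = N y" by simp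
    moreover have "card (N x) = k\<^sup>2" using le * \<open>N x \<inter> N y = N x\<close> by simp
    ultimately show False using isomorphic_K2[OF xy(1,2)] K2 by simp
  qed
  then show ?thesis using core_parallel[OF xy] by blast
next
  case False
  have uniq: "w = w'" if "x \<noteq> y" "3 \<le> card (N x)" "3 \<le> card (N y)"
      "w \<in> N x" "w \<in> N y" "w' \<in> N x" "w' \<in> N y" for x y w w'
  proof (rule ccontr)
    assume "w \<noteq> w'"
    then have "card {w, w'} = 2" by simp
    moreover have "card {w, w'} \<le> card (N x \<inter> N y)"
      by (rule card_mono) (use finite_N that in auto)
    ultimately show False using False that by auto
  qed
  obtain u n where u: "cyclic_path u n" "3 \<le> card (N (u 0))"
    by (rule cyclic_path_exists) (blast intro: subdiv)+
  show ?thesis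
    by (rule core_cycle[OF _ _ u]) (fact subdiv, fact uniq)
qed

lemma distinguishable_big:
  assumes h: "h \<in> V" "3 \<le> card (N h)"
    and K2: "\<not> isomorphic_graphs V E (complete_bipartite_verts 2 (k\<^sup>2)) (complete_bipartite_edges 2 (k\<^sup>2))"
  shows distinguishable
proof (cases "\<forall>u w. w \<in> N u \<longrightarrow> card (N u) = 2 \<longrightarrow> 3 \<le> card (N w)")
  case True
  then show ?thesis using distinguishable_subdivided K2 by blast
next
  case False
  \<comment> \<open>An edge from \<open>v\<close> in \<open>S\<close> to \<open>x\<close> outside
    must end at a large vertex, since a neighbour of \<open>v\<close> of degree 2 would itself be in
    \<open>S\<close>. The other neighbour of \<open>v\<close> then has degree 2, giving a path or
    triangle core.\<close>
  define S where "S = {u \<in> V. card (N u) = 2 \<and> (\<exists>w\<in>N u. card (N w) = 2)}"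
  obtain u w where uw: "w \<in> N u" "card (N u) = 2" "\<not> 3 \<le> card (N w)" using False by blast
  then have "card (N w) = 2" using N_big_cases[OF N_V[OF uw(1)]] by simp
  then have "u \<in> S" using uw N_V'[OF uw(1)] by (auto simp: S_def)
  moreover have "h \<notin> S" using h by (simp add: S_def)
  then have "S \<subseteq> V" "S \<noteq> V" using h(1) by (auto simp: S_def)
  ultimately obtain v x where vx: "v \<in> S" "x \<in> N v" "x \<notin> S" using boundary_edge[of S] by blast
  then have v2: "card (N v) = 2" by (simp add: S_def)
  then have "card (N x) \<noteq> 2" using vx N_sym[OF vx(2)] N_V[OF vx(2)] by (auto simp: S_def)
  then have x3: "3 \<le> card (N x)" using N_big_cases[OF N_V[OF vx(2)]] by simp
  obtain z where z: "N v = {x, z}" "z \<noteq> x" using N_other[OF v2 vx(2)] by metis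
  then have z2: "card (N z) = 2" using vx(1) x3 by (auto simp: S_def)
  show ?thesis
  proof (cases "z \<in> N x")
    case False
    then show ?thesis using core_path3[OF x3 z(1) z2] by simp
  next
    case True
    have "v \<in> N z" using N_sym[of z v] z by simp
    then obtain y where y: "N z = {v, y}" using N_other[OF z2] by metis
    have "x \<in> N z" using N_sym[OF True] .
    moreover have "x \<noteq> v" using v2 x3 by auto
    ultimately have "N z = {x, v}" using y by auto
    then show ?thesis using core_triangle[OF x3 z(1)] by simp
  qed
qed

section \<open>Graphs in which all degrees are 2\<close>

text \<open>A walk that never turns back runs once around the graph and identifies it with a cycle
  of length \<open>n\<close>. For \<open>n \<ge> 6\<close> two labels suffice: label 1 on the edges
  01, 12 and 34 leaves no rotation or reflection.\<close>

lemma distinguishable_cycle: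
  assumes deg2: "\<And>v. v \<in> V \<Longrightarrow> card (N v) = 2"
    and no_small: "\<forall>n\<in>{3, 4, 5}. \<not> isomorphic_graphs V E (cycle_verts n) (cycle_edges n)"
  shows distinguishable
proof -
  \<comment> \<open>The vertex that follows \<open>a, b\<close> on a walk without turning
    back.\<close>
  define other where "other = (\<lambda>a b. SOME z. N b = {a, z} \<and> z \<noteq> a)"
  have other: "N b = {a, other a b}" "other a b \<noteq> a" if "a \<in> N b" for a b
  proof -
    have "\<exists>z. N b = {a, z} \<and> z \<noteq> a" using N_other[OF deg2[OF N_V'[OF that]] that] by metis
    from someI_ex[OF this] show "N b = {a, other a b}" "other a b \<noteq> a" by (simp_all add: other_def)
  qed
  have "V \<noteq> {}" using conn by (simp add: connected_graph_def)
  then obtain x0 where x0: "x0 \<in> V" by auto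
  then obtain x1 where x1: "x1 \<in> N x0" using deg2[OF x0] by fastforce
  define W where "W = rec_nat (x0, x1) (\<lambda>_ (a, b). (b, other a b))"
  define u where "u = (\<lambda>i. fst (W i))"
  have WS: "W (Suc i) = (snd (W i), other (fst (W i)) (snd (W i)))" for i
    by (simp add: W_def case_prod_beta)
  have u0: "u 0 = x0" "u 1 = x1" and uSS: "u (Suc (Suc i)) = other (u i) (u (Suc i))" for i
    using WS by (simp_all add: u_def) (simp_all add: W_def)
  have adj: "u (Suc i) \<in> N (u i)" for i
  proof (induction i)
    case 0 then show ?case using u0 x1 by simp
  next
    case (Suc i)
    then show ?case using other(1)[OF N_sym[OF Suc]] uSS by simp
  qed
  note adj' = N_sym[OF adj]
  have NS: "N (u (Suc i)) = {u i, u (Suc (Suc i))}" "u (Suc (Suc i)) \<noteq> u i" for i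
    using other[OF adj'] uSS by simp_all
  have uV: "u i \<in> V" for i using N_V[OF adj'] .
  have une: "u (Suc i) \<noteq> u i" for i using adj[of i] N_irrefl by metis
  \<comment> \<open>The first time at which the walk revisits a vertex.\<close>
  define n where "n = (LEAST n. u n \<in> u ` {..<n})"
  have "\<not> inj u"
  proof
    assume "inj u"
    then have "infinite (range u)" using finite_imageD infinite_UNIV_nat by blast
    then show False using finite_subset[OF _ finite_V, of "range u"] uV by blast
  qed
  then obtain a b where "u a = u b" "a \<noteq> b" by (auto simp: inj_on_def)
  then have "\<exists>a b. u a = u b \<and> a < b" by (metis nat_neq_iff)
  then have "\<exists>n. u n \<in> u ` {..<n}" by (metis imageI lessThan_iff)
  then have n: "u n \<in> u ` {..<n}" unfolding n_def by (rule LeastI_ex)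
  have lessn: "u m \<notin> u ` {..<m}" if "m < n" for m using not_less_Least that unfolding n_def by blast
  have u_eq: "i = j" if "i < n" "j < n" "u i = u j" for i j
    using lessn[of i] lessn[of j] that by (metis imageI lessThan_iff nat_neq_iff)
  obtain j where j: "j < n" "u n = u j" using n by auto
  have n3: "3 \<le> n"
  proof -
    have "n \<noteq> 1" using j une[of 0] by auto
    moreover have "n \<noteq> 2" using j une[of 1] NS(2)[of 0] by (auto simp: numeral_2_eq_2 less_Suc_eq)
    ultimately show ?thesis using j by simp
  qed
  \<comment> \<open>A first return to \<open>u j\<close> with \<open>j > 0\<close> would make
    \<open>u (n - 1)\<close> one of the two neighbours \<open>u (j - 1)\<close>,
    \<open>u (j + 1)\<close> of \<open>u j\<close>, against minimality of \<open>n\<close> or the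
    absence of turns.\<close>
  have un: "u n = u 0"
  proof (cases j)
    case (Suc i)
    obtain m where m: "n = Suc m" using n3 by (cases n) auto
    have "u m \<in> N (u j)" using adj'[of m] j m by simp
    then have "u m = u i \<or> u m = u (Suc j)" using NS(1)[of i] Suc by simp
    moreover have "u m \<noteq> u i" using u_eq[of m i] m j Suc by auto
    moreover have "u m \<noteq> u (Suc j)"
    proof
      assume *: "u m = u (Suc j)"
      show False
      proof (cases "Suc j < n")
        case True
        then have "m = Suc j" using * u_eq[of m "Suc j"] m by simp
        then show False using NS(2)[of j] j m by simp
      next
        case False
        then have "m = j" using j m by simp
        then show False using * une[of j] by simp
      qed
    qed
    ultimately show ?thesis by simp
  qed (use j in simp)
  define l where "l = n - 1"
  have l: "n = Suc l" "2 \<le> l" using n3 by (auto simp: l_def)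
  have N0: "N (u 0) = {u l, u 1}"
  proof -
    have "u l \<in> N (u 0)" "u 1 \<in> N (u 0)" using adj'[of l] adj[of 0] un l by simp_all
    moreover have "u 1 \<noteq> u l" using u_eq[of 1 l] l by auto
    ultimately show ?thesis using other(1)[of "u l" "u 0"] by auto
  qed
  have V: "V = u ` {..<n}"
  proof (rule ccontr)
    assume "V \<noteq> u ` {..<n}"
    moreover have "0 \<in> {..<n}" using n3 by simp
    then have "u ` {..<n} \<subseteq> V" "u ` {..<n} \<noteq> {}" using uV by blast+
    ultimately obtain v w where vw: "v \<in> u ` {..<n}" "w \<in> N v" "w \<notin> u ` {..<n}"
      using boundary_edge[of "u ` {..<n}"] by metis
    then obtain i where i: "i < n" "v = u i" by auto
    show False
    proof (cases i)
      case 0 then show False using vw N0 i l by auto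
    next
      case (Suc i')
      then have "w \<in> {u i', u (Suc i)}" using vw i NS(1)[of i'] by simp
      moreover have "u (Suc i) \<in> u ` {..<n}"
        using un n3 i by (cases "Suc i = n") auto
      ultimately show False using vw i Suc by auto
    qed
  qed
  have umod: "u (Suc i mod n) = u (Suc i)" if "i < n" for i
    using that un by (cases "Suc i = n") auto
  have inj: "inj_on u {..<n}" using u_eq by (auto simp: inj_on_def)
  have adj_iff: "u a \<in> N (u b) \<longleftrightarrow> (\<exists>i<n. {b, a} = {i, Suc i mod n})" if ab: "a < n" "b < n" for a b
  proof
    assume a: "u a \<in> N (u b)"
    show "\<exists>i<n. {b, a} = {i, Suc i mod n}"
    proof (cases b)
      case 0
      then have "a = l \<or> a = 1" using a N0 u_eq[of a l] u_eq[of a 1] ab l by auto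
      then show ?thesis
      proof
        assume "a = l" then show ?thesis using 0 l by (intro exI[of _ l]) auto
      next
        assume "a = 1" then show ?thesis using 0 l by (intro exI[of _ 0]) auto
      qed
    next
      case (Suc b')
      then have "u a = u b' \<or> u a = u (Suc b)" using a NS(1)[of b'] by simp
      then have "u a = u b' \<or> u a = u (Suc b mod n)" using umod ab by simp
      then have "a = b' \<or> a = Suc b mod n" using u_eq[of a b'] u_eq[of a "Suc b mod n"] ab Suc by auto
      then show ?thesis
      proof
        assume "a = b'" then show ?thesis using Suc ab by (intro exI[of _ b']) auto
      next
        assume "a = Suc b mod n" then show ?thesis using ab by (intro exI[of _ b]) auto
      qed
    qed
  next
    assume "\<exists>i<n. {b, a} = {i, Suc i mod n}"
    then obtain i where "i < n" "{b, a} = {i, Suc i mod n}" by blast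
    then have "(b = i \<and> u a = u (Suc i)) \<or> (u b = u (Suc i) \<and> a = i)"
      using umod by (auto simp: doubleton_eq_iff)
    then show "u a \<in> N (u b)" using adj[of i] adj'[of i] by auto
  qed
  have "isomorphic_graphs V E (cycle_verts n) (cycle_edges n)"
    unfolding isomorphic_graphs_def graph_iso_def
  proof (intro exI conjI ballI)
    let ?g = "the_inv_into {..<n} u"
    show "bij_betw ?g V (cycle_verts n)"
      using bij_betw_the_inv_into[of u "{..<n}" V] inj V by (simp add: bij_betw_def cycle_verts_def)
    fix v w assume "v \<in> V" "w \<in> V"
    then obtain a b where ab: "v = u a" "w = u b" "a < n" "b < n" using V by auto
    have "?g v = a" "?g w = b" using ab the_inv_into_f_f[OF inj] by auto
    moreover have "{a, b} \<in> cycle_edges n \<longleftrightarrow> (\<exists>i<n. {a, b} = {i, Suc i mod n})"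
      by (auto simp: cycle_edges_def)
    ultimately show "{v, w} \<in> E \<longleftrightarrow> {?g v, ?g w} \<in> cycle_edges n"
      using adj_iff[of b a] ab by (simp add: nbrs_def)
  qed
  then have "n \<notin> {3, 4, 5}" using no_small by blast
  then have n6: "6 \<le> n" using n3 by auto
  then have l5: "5 \<le> l" "l < n" using l by simp_all
  define c :: "'a set \<Rightarrow> nat" where "c = (\<lambda>e. if e \<in> {{u 0, u 1}, {u 1, u 2}, {u 3, u 4}} then 1 else 0)"
  have c_eq: "c {u a, u b} = (if {a, b} \<in> {{0, 1}, {1, 2}, {3, 4}} then 1 else 0)" if "a < n" "b < n" for a b
  proof -
    have "{u a, u b} = {u i, u j} \<longleftrightarrow> {a, b} = {i, j}" if "i \<le> 4" "j \<le> 4" for i j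
      using u_eq \<open>a < n\<close> \<open>b < n\<close> that n6 by (auto simp: doubleton_eq_iff)
    then show ?thesis by (simp add: c_def)
  qed
  have c_cases: "a = 0 \<and> b = 1 \<or> a = 1 \<and> b = 0 \<or> a = 1 \<and> b = 2 \<or> a = 2 \<and> b = 1 \<or> a = 3 \<and> b = 4 \<or> a = 4 \<and> b = 3"
    if "c {u a, u b} = 1" "a < n" "b < n" for a b
  proof -
    have "{a, b} \<in> {{0, 1}, {1, 2}, {3, 4}}" using that c_eq[of a b] by (metis zero_neq_one)
    then show ?thesis by (simp add: doubleton_eq_iff)
  qed
  have "f v = v" if f: "label_auto V E c f" and v: "v \<in> V" for f v
  proof -
    have lab: "c {f (u i), f (u (Suc i))} = c {u i, u (Suc i)}" for i using auto_label[OF f adj] by simp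
    have Nf: "N (f (u (Suc i))) = {f (u i), f (u (Suc (Suc i)))}" for i using auto_N[OF f uV] NS(1) by simp
    have small: "i < n" if "i \<le> 5" for i using that n6 by simp
    have f1: "f (u 1) = u 1"
    proof -
      have l1: "c {f (u 1), y} = 1" if "y \<in> N (f (u 1))" for y
      proof -
        have "c {f (u 0), f (u 1)} = 1" using lab[of 0] by (simp add: c_def)
        then have "c {f (u 1), f (u 0)} = 1" by (simp add: insert_commute)
        moreover have "c {f (u 1), f (u 2)} = 1" using lab[of 1] by (simp add: c_def numeral_2_eq_2)
        moreover have "y = f (u 0) \<or> y = f (u 2)" using that Nf[of 0] by (simp add: numeral_2_eq_2)
        ultimately show ?thesis by metis
      qed
      have "f (u 1) \<in> u ` {..<n}" using auto_V[OF f uV, of 1] unfolding V[symmetric] .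
      then obtain i where i: "i < n" "f (u 1) = u i" by auto
      show ?thesis
      proof (cases i)
        case 0
        then have "c {u 0, u l} = 1" using l1[of "u l"] i N0 by simp
        then have False using c_cases[of 0 l] l5 by linarith
        then show ?thesis ..
      next
        \<comment> \<open>Label 1 towards the predecessor leaves \<open>i\<close> among 1, 2, 4, and
          towards the successor among 0, 1, 3. So \<open>u 1\<close> is the only vertex with two
          edges labeled 1.\<close>
        case (Suc m)
        have "c {u i, u m} = 1" "c {u i, u (Suc i)} = 1"
          using l1[of "u m"] l1[of "u (Suc i)"] NS(1)[of m] unfolding i(2) Suc by simp_all
        then have "i = 1 \<and> m = 0 \<or> i = 2 \<and> m = 1 \<or> i = 4 \<and> m = 3"
          using c_cases[of i m] i(1) Suc by fastforce
        moreover from this have "Suc i < n" using n6 by linarith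
        then have "i = 0 \<or> i = 1 \<or> i = 3"
          using c_cases[OF \<open>c {u i, u (Suc i)} = 1\<close> i(1)] by linarith
        ultimately have "i = 1" by linarith
        then show ?thesis using i by simp
      qed
    qed
    have f02: "{f (u 0), f (u 2)} = {u 0, u 2}" using Nf[of 0] f1 NS(1)[of 0] by (simp add: numeral_2_eq_2)
    have f0: "f (u 0) = u 0"
    proof (rule ccontr)
      assume "f (u 0) \<noteq> u 0"
      \<comment> \<open>The reflection at \<open>u 1\<close> would move the edge labeled 1 between
        \<open>u 3\<close> and \<open>u 4\<close> to an edge at \<open>u l\<close>, but
        \<open>l \<ge> 5\<close> and all edges there have label 0.\<close>
      then have f2: "f (u 2) = u 0" using f02 by (auto simp: doubleton_eq_iff)
      have "{u 1, f (u 3)} = {u l, u 1}"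
        using Nf[of 1] f1 f2 N0 by (simp add: numeral_2_eq_2 numeral_3_eq_3)
      moreover have "u 1 \<noteq> u l" using u_eq[of 1 l] l by auto
      ultimately have f3: "f (u 3) = u l" by (auto simp: doubleton_eq_iff)
      have "f (u 4) \<in> u ` {..<n}" using auto_V[OF f uV, of 4] unfolding V[symmetric] .
      then obtain i where i: "i < n" "f (u 4) = u i" by auto
      have "c {f (u 3), f (u 4)} = 1" using lab[of 3] c_eq[of 3 4] small by simp
      then have "c {u l, u i} = 1" unfolding f3 i(2) .
      then show False using c_cases[of l i] i(1) l5 by linarith
    qed
    have "f (u i) = u i \<and> f (u (Suc i)) = u (Suc i)" for i
    proof (induction i)
      case (Suc i)
      then have "{u i, f (u (Suc (Suc i)))} = {u i, u (Suc (Suc i))}" using Nf[of i] NS(1)[of i] by simp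
      then show ?case using Suc by (auto simp: doubleton_eq_iff)
    qed (use f0 f1 in simp)
    then show ?thesis using v unfolding V by blast
  qed
  then have "distinguishing_edge_labeling V E c"
    by (simp add: distinguishing_edge_labeling_def label_auto_def)
  moreover have "\<forall>e\<in>E. c e < k" using k_ge by (simp add: c_def)
  ultimately show ?thesis unfolding distinguishable_def by (intro exI conjI)
qed

end

section \<open>From minimality to the bound on the distinguishing index\<close>

lemma vertex_degree_ge_min:
  assumes "finite V" "v \<in> V"
  shows "min_degree V E \<le> vertex_degree E v"
  using assms by (simp add: min_degree_def)

text \<open>Deleting \<open>{u, v}\<close> lowers the minimum degree, yet only \<open>u\<close> and
  \<open>v\<close> lose an edge, and just one each; so one of them had degree exactly
  \<open>d\<close>.\<close>

lemma minimally_graph_edge_degree: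
  assumes "minimally_graph d V E" "{u, v} \<in> E"
  shows "vertex_degree E u = d \<or> vertex_degree E v = d"
proof -
  have fin: "finite V" and ne: "V \<noteq> {}" and min: "min_degree V E = d"
    using assms(1) by (auto simp: minimally_graph_def simple_graph_def connected_graph_def)
  have "finite E"
    by (rule finite_subset[of _ "Pow V"]) (use assms(1) in \<open>auto simp: minimally_graph_def simple_graph_def\<close>)
  define E' where "E' = E - {{u, v}}"
  have "min_degree V E' < d"
    using assms unfolding minimally_graph_def E'_def by blast
  moreover have "min_degree V E' \<in> vertex_degree E' ` V"
    unfolding min_degree_def using fin ne by (intro Min_in) auto
  ultimately obtain x where x: "x \<in> V" "vertex_degree E' x < d" by auto
  have ge: "d \<le> vertex_degree E x" using vertex_degree_ge_min[OF fin x(1), of E] min by simp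
  have eq: "{e \<in> E'. x \<in> e} = {e \<in> E. x \<in> e} - {{u, v}}" by (auto simp: E'_def)
  have "vertex_degree E x \<le> Suc (vertex_degree E' x)"
    unfolding vertex_degree_def eq using \<open>finite E\<close> by (simp add: card_Diff_singleton_if, arith)
  moreover have "x = u \<or> x = v"
  proof (rule ccontr)
    assume "\<not> ?thesis"
    then have "{e \<in> E'. x \<in> e} = {e \<in> E. x \<in> e}" by (auto simp: E'_def)
    then show False using x ge by (simp add: vertex_degree_def)
  qed
  ultimately show ?thesis using x(2) ge by auto
qed

theorem theorem4p2:
  fixes V :: "'a set" and E :: "'a set set" and \<Delta> :: nat
  assumes "minimally_graph 2 V E"
    and "max_degree V E = \<Delta>"
    and "\<forall>n\<in>{3, 4, 5}. \<not> isomorphic_graphs V E (cycle_verts n) (cycle_edges n)"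
    and "\<forall>r::nat. r \<ge> 1 \<longrightarrow>
           \<not> isomorphic_graphs V E (complete_bipartite_verts 2 (r\<^sup>2)) (complete_bipartite_edges 2 (r\<^sup>2))"
  shows "int (distinguishing_index V E) \<le> \<lceil>sqrt (real \<Delta>)\<rceil>"
proof -
  define k where "k = nat \<lceil>sqrt (real \<Delta>)\<rceil>"
  have simple: "simple_graph V E" and conn: "connected_graph V E" and min: "min_degree V E = 2"
    using assms(1) by (auto simp: minimally_graph_def)
  then have fin: "finite V" and ne: "V \<noteq> {}" by (auto simp: simple_graph_def connected_graph_def)
  note deg = vertex_degree_eq_card_nbrs[OF simple]
  have ge: "2 \<le> card (nbrs E v)" if "v \<in> V" for v
    using vertex_degree_ge_min[OF fin that, of E] min deg by simp
  have le: "card (nbrs E v) \<le> \<Delta>" if "v \<in> V" for v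
  proof -
    have "vertex_degree E v \<le> max_degree V E"
      unfolding max_degree_def using that fin by (intro Max_ge) auto
    then show ?thesis using deg assms(2) by simp
  qed
  have "2 \<le> \<Delta>" using ne ge le by (meson ex_in_conv order_trans)
  \<comment> \<open>A square root above 1 has ceiling at least 2, so two labels are always
    available.\<close>
  then have "1 < sqrt (real \<Delta>)" by simp
  then have k2: "2 \<le> k" unfolding k_def by linarith
  have "sqrt (real \<Delta>) \<le> real k" unfolding k_def by linarith
  then have "real \<Delta> \<le> (real k)\<^sup>2" by (rule sqrt_le_D)
  then have "\<Delta> \<le> k\<^sup>2" by (metis of_nat_le_iff of_nat_power)
  then have le': "card (nbrs E v) \<le> k\<^sup>2" if "v \<in> V" for v using le[OF that] by simp
  interpret sparse_graph V E k
    by unfold_locales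
      (use simple conn ge le' k2 minimally_graph_edge_degree[OF assms(1)] deg in auto)
  have distinguishable
  proof (cases "\<exists>h\<in>V. 3 \<le> card (nbrs E h)")
    case True
    \<comment> \<open>The exclusion of complete bipartite graphs is applied with
      \<open>r = k\<close>.\<close>
    have "\<not> isomorphic_graphs V E (complete_bipartite_verts 2 (k\<^sup>2)) (complete_bipartite_edges 2 (k\<^sup>2))"
      using assms(4) k2 by simp
    then show ?thesis using True distinguishable_big by blast
  next
    case False
    then have "card (nbrs E v) = 2" if "v \<in> V" for v using N_big_cases[OF that] that by blast
    then show ?thesis using distinguishable_cycle assms(3) by blast
  qed
  then have "distinguishing_index V E \<le> k"
    unfolding distinguishing_index_def distinguishable_def by (rule Least_le)
  then show ?thesis using k2 by (simp add: k_def)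
qed

end
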